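(* The category $\mathcal{W}\mathrm{Seq}$ of Whitehead sequences in the category $\mathcal{X}\mathrm{Act}$ of actions of crossed modules (with respect to the ordered triple of functors $(I,R,J)$ between $\mathcal{X}\mathrm{Act}$ and the category $\mathcal{X}\mathrm{Mod}$ of crossed modules defined in the context) and the category $\mathcal{X}\mathrm{Sq}$ of crossed squares are isomorphic.
   Context: **Crossed modules.** A crossed module $(T,G,\partial)$ is a group homomorphism $\partial:T\to G$ with an action of $G$ on $T$ (by group automorphisms) such that $\partial({}^xt)=x\partial(t)x^{-1}$ and ${}^{\partial(t)}t'=tt't^{-1}$. A morphism $(f_T,f_G):(T_1,G_1,\partial_1)\to(T_2,G_2,\partial_2)$ is a pair of group homomorphisms $f_T:T_1\to T_2$, $f_G:G_1\to G_2$ with $\partial_2 f_T=f_G\partial_1$ and $f_T({}^xt)={}^{f_G(x)}f_T(t)$. These form the category $\mathcal{X}\mathrm{Mod}$. A 2-morphism $\alpha:(f_T,f_G)\Rightarrow(f'_T,f'_G)$ between parallel morphisms is a map $\alpha:G_1\to T_2$ with $f'_G(x)=\partial_2(\alpha(x))f_G(x)$, $f'_T(t)=\alpha(\partial_1(t))f_T(t)$ and $\alpha(xx')=\alpha(x)\,{}^{f_G(x)}\alpha(x')$. Vertical composition is $(\beta\circ\alpha)(x)=\beta(x)\alpha(x)$; horizontal composition of $\alpha:(f_T,f_G)\Rightarrow(f'_T,f'_G)$ followed by $\beta:(g_T,g_G)\Rightarrow(g'_T,g'_G)$ is $(\beta*\alpha)(x)=\beta(f'_G(x))\,g_T(\alpha(x))$.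 This gives the 2-category $\mathbb{X}\mathrm{Mod}$ of crossed modules. **2-category of a crossed module.** $\underline{(M,P,\mu)}$ is the groupoid with objects the elements of $P$ and morphisms the pairs $(m,p)\in M\times P$, with $(m,p):p\to\mu(m)p$ and $(m_2,p_2)\circ(m_1,p_1)=(m_2m_1,p_1)$ when $p_2=\mu(m_1)p_1$. $\underline{\underline{(M,P,\mu)}}$ is the 2-category with one object $\circ$, hom-category $\underline{(M,P,\mu)}$, and composition functor given by multiplication in $P$ on objects and multiplication $(m',p')(m,p)=(m'\,{}^{p'}m,p'p)$ in $M\rtimes P$ on morphisms. A morphism of crossed modules $(\alpha_M,\alpha_P)$ induces a strict 2-functor $A$, $p\mapsto\alpha_P(p)$, $(m,p)\mapsto(\alpha_M(m),\alpha_P(p))$. **The category $\mathcal{X}\mathrm{Act}$.** An object (an action of $(M,P,\mu)$ on $(T,G,\partial)$) is a pair $(X,(M,P,\mu))$ with $X:\underline{\underline{(M,P,\mu)}}\to\mathbb{X}\mathrm{Mod}$ a strict 2-functor and $X(\circ)=(T,G,\partial)$. Write $X_\circ$ for its functor on hom-categories, $X_\circ(p)=(\theta_p,\sigma_p)$ (an automorphism of $(T,G,\partial)$), and regard $X_\circ(m,p)$ as a map $G\to T$. A morphism $(N,(\alpha_M,\alpha_P)):(X_1,(M_1,P_1,\mu_1))\to(X_2,(M_2,P_2,\mu_2))$ consists of a morphism of crossed modules $(\alpha_M,\alpha_P):(M_1,P_1,\mu_1)\to(M_2,P_2,\mu_2)$ and a strict transformation $N:X_1\Rightarrow X_2\circ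 A$, $A$ being the 2-functor induced by $(\alpha_M,\alpha_P)$; that is, a morphism of crossed modules $N_\circ=(N_T,N_G):X_1(\circ)\to X_2(\circ)$ with $N_\circ\circ X_{1\circ}(p)=X_{2\circ}(\alpha_P(p))\circ N_\circ$ for all $p\in P_1$ and $N_T\circ X_{1\circ}(m,p)=X_{2\circ}(\alpha_M(m),\alpha_P(p))\circ N_G$ for all $(m,p)\in M_1\rtimes P_1$. **Conjugation action.** $(\mathsf{C},(M,P,\mu))$ is the action of $(M,P,\mu)$ on itself with $\mathsf{C}_\circ(p)=(\psi_p,\varphi_p)$, $\psi_p(m)={}^pm$, $\varphi_p(p')=pp'p^{-1}$, and $\mathsf{C}_\circ(m,p)=\eta(m)\circ\varphi_p$ where $\eta(m)(p')=m\,{}^{p'}m^{-1}$. **The functors.** $I:\mathcal{X}\mathrm{Act}\to\mathcal{X}\mathrm{Mod}$, $(X,(M,P,\mu))\mapsto(M,P,\mu)$, $(N,(\alpha_M,\alpha_P))\mapsto(\alpha_M,\alpha_P)$; $J:\mathcal{X}\mathrm{Act}\to\mathcal{X}\mathrm{Mod}$, $(X,(M,P,\mu))\mapsto X(\circ)$, $(N,(\alpha_M,\alpha_P))\mapsto N_\circ$; $R:\mathcal{X}\mathrm{Mod}\to\mathcal{X}\mathrm{Act}$, $(M,P,\mu)\mapsto(\mathsf{C},(M,P,\mu))$, sending a morphism $a$ to the morphism of actions with $I$- and $J$-image $a$. Thus $I\circ R=\mathrm{id}=J\circ R$. **Whitehead sequences.** A Whitehead sequence in $\mathcal{X}\mathrm{Act}$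 with respect to $(I,R,J)$ is a triple $(A,u,v)$ with $A$ an object of $\mathcal{X}\mathrm{Act}$ and morphisms $u:A\to RI(A)$, $v:RJ(A)\to A$ such that $I(u)=\mathrm{id}_{I(A)}$, $J(v)=\mathrm{id}_{J(A)}$, $I(v)=J(u)$. A morphism $(A_1,u_1,v_1)\to(A_2,u_2,v_2)$ is a morphism $n:A_1\to A_2$ in $\mathcal{X}\mathrm{Act}$ with $n\circ v_1=v_2\circ RJ(n)$ and $u_2\circ n=RI(n)\circ u_1$. These form the category $\mathcal{W}\mathrm{Seq}$. **Crossed squares.** A crossed square is a commutative square of group homomorphisms $f:T\to M$, $\partial:T\to G$, $\mu:M\to P$, $g:G\to P$ ($\mu f=g\partial$) with actions of $P$ on $T$, $M$, $G$ and a function $\phi:M\times G\to T$ such that, for all elements (with $G$ and $M$ acting via $g$ and $\mu$): (1) $f$ and $\partial$ are $P$-equivariant; (2) $\mu$, $g$ and $\mu f=g\partial$ are crossed modules; (3) $f\phi(m,x)=m\,{}^{g(x)}m^{-1}$; (4) $\partial\phi(m,x)={}^{\mu(m)}x\,x^{-1}$; (5) $\phi(f(t),x)=t\,{}^{g(x)}t^{-1}$; (6) $\phi(m,\partial(t))={}^{\mu(m)}t\,t^{-1}$; (7) $\phi(m_0m_1,x)={}^{\mu(m_0)}\phi(m_1,x)\,\phi(m_0,x)$; (8) $\phi(m,x_0x_1)=\phi(m,x_0)\,{}^{g(x_0)}\phi(m,x_1)$; (9) ${}^p\phi(m,x)=\phi({}^pm,{}^px)$. A morphism of crossed squares consists of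 four group homomorphisms $T_1\to T_2$, $M_1\to M_2$, $G_1\to G_2$, $P_1\to P_2$ commuting with the structure maps and compatible with the actions and with $\phi_1,\phi_2$. These form the category $\mathcal{X}\mathrm{Sq}$. *)

theory Defs
  imports "HOL-Algebra.Bij"
begin

text \<open>
  All groups live on one arbitrary type \<open>'u\<close>, which plays the role of the universe: an object of a
  category below may be built from any groups whose carriers are subsets of \<open>'u\<close>.
  An isomorphism of categories is sensitive to equality of objects and of arrows. Every function
  that is part of an object or of an arrow is therefore required to be \<open>undefined\<close> outside its
  mathematical domain, so that equality in HOL is equality of the mathematical objects; and every
  arrow carries its source and its target.
\<close>

section \<open>Categories and 2-categories\<close>

record ('o, 'a) cat =
  Obj :: "'o set"
  Arr :: "'a set"
  Dom :: "'a \<Rightarrow> 'o"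
  Cod :: "'a \<Rightarrow> 'o"
  Idn :: "'o \<Rightarrow> 'a"
  Cmp :: "'a \<Rightarrow> 'a \<Rightarrow> 'a"  \<comment> \<open>\<open>Cmp C g f\<close> is \<open>g\<close> after \<open>f\<close>\<close>

locale category =
  fixes C :: "('o, 'a) cat"
  assumes dom_cod: "f \<in> Arr C \<Longrightarrow> Dom C f \<in> Obj C \<and> Cod C f \<in> Obj C"
    and idn: "x \<in> Obj C \<Longrightarrow> Idn C x \<in> Arr C \<and> Dom C (Idn C x) = x \<and> Cod C (Idn C x) = x"
    and cmp: "\<lbrakk>f \<in> Arr C; g \<in> Arr C; Cod C f = Dom C g\<rbrakk> \<Longrightarrow>
      Cmp C g f \<in> Arr C \<and> Dom C (Cmp C g f) = Dom C f \<and> Cod C (Cmp C g f) = Cod C g"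
    and idn_right: "f \<in> Arr C \<Longrightarrow> Cmp C f (Idn C (Dom C f)) = f"
    and idn_left: "f \<in> Arr C \<Longrightarrow> Cmp C (Idn C (Cod C f)) f = f"
    and assoc: "\<lbrakk>f \<in> Arr C; g \<in> Arr C; h \<in> Arr C; Cod C f = Dom C g; Cod C g = Dom C h\<rbrakk> \<Longrightarrow>
      Cmp C h (Cmp C g f) = Cmp C (Cmp C h g) f"

record ('o, 'a, 'p, 'b) functor_data =
  on_obj :: "'o \<Rightarrow> 'p"
  on_arr :: "'a \<Rightarrow> 'b"

locale cat_functor = category C + D: category D
  for C :: "('o, 'a) cat" and D :: "('p, 'b) cat" +
  fixes F :: "('o, 'a, 'p, 'b) functor_data"
  assumes on_obj: "x \<in> Obj C \<Longrightarrow> on_obj F x \<in> Obj D"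
    and on_arr: "f \<in> Arr C \<Longrightarrow> on_arr F f \<in> Arr D \<and>
      Dom D (on_arr F f) = on_obj F (Dom C f) \<and> Cod D (on_arr F f) = on_obj F (Cod C f)"
    and on_idn: "x \<in> Obj C \<Longrightarrow> on_arr F (Idn C x) = Idn D (on_obj F x)"
    and on_cmp: "\<lbrakk>f \<in> Arr C; g \<in> Arr C; Cod C f = Dom C g\<rbrakk> \<Longrightarrow>
      on_arr F (Cmp C g f) = Cmp D (on_arr F g) (on_arr F f)"

definition isomorphic_categories :: "('o, 'a) cat \<Rightarrow> ('p, 'b) cat \<Rightarrow> bool" where
  "isomorphic_categories C D \<longleftrightarrow> (\<exists>F G. cat_functor C D F \<and> cat_functor D C G \<and>
    (\<forall>x\<in>Obj C. on_obj G (on_obj F x) = x) \<and> (\<forall>f\<in>Arr C. on_arr G (on_arr F f) = f) \<and>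
    (\<forall>y\<in>Obj D. on_obj F (on_obj G y) = y) \<and> (\<forall>g\<in>Arr D. on_arr F (on_arr G g) = g))"

text \<open>
  A (strict) 2-category consists of the category \<open>cells1\<close> of 0-cells and 1-cells, the category
  \<open>vert\<close> of 1-cells and 2-cells under vertical composition (the disjoint union of all
  hom-categories), and a horizontal composition of 2-cells, \<open>HCmp K \<beta> \<alpha>\<close> being \<open>\<beta> * \<alpha>\<close>.
\<close>

record ('o, 'a, 'b) two_cat =
  cells1 :: "('o, 'a) cat"
  vert :: "('a, 'b) cat"
  HCmp :: "'b \<Rightarrow> 'b \<Rightarrow> 'b"

definition dom0 :: "('o, 'a, 'b) two_cat \<Rightarrow> 'b \<Rightarrow> 'o" where
  "dom0 K \<alpha> = Dom (cells1 K) (Dom (vert K) \<alpha>)"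

definition cod0 :: "('o, 'a, 'b) two_cat \<Rightarrow> 'b \<Rightarrow> 'o" where
  "cod0 K \<alpha> = Cod (cells1 K) (Dom (vert K) \<alpha>)"

locale two_category =
  fixes K :: "('o, 'a, 'b) two_cat"
  assumes cells1: "category (cells1 K)"
    and vert: "category (vert K)"
    and vert_obj: "Obj (vert K) = Arr (cells1 K)"
    and parallel: "\<alpha> \<in> Arr (vert K) \<Longrightarrow>
      Dom (cells1 K) (Dom (vert K) \<alpha>) = Dom (cells1 K) (Cod (vert K) \<alpha>) \<and>
      Cod (cells1 K) (Dom (vert K) \<alpha>) = Cod (cells1 K) (Cod (vert K) \<alpha>)"
    and hcmp: "\<lbrakk>\<alpha> \<in> Arr (vert K); \<beta> \<in> Arr (vert K); cod0 K \<alpha> = dom0 K \<beta>\<rbrakk> \<Longrightarrow>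
      HCmp K \<beta> \<alpha> \<in> Arr (vert K) \<and>
      Dom (vert K) (HCmp K \<beta> \<alpha>) = Cmp (cells1 K) (Dom (vert K) \<beta>) (Dom (vert K) \<alpha>) \<and>
      Cod (vert K) (HCmp K \<beta> \<alpha>) = Cmp (cells1 K) (Cod (vert K) \<beta>) (Cod (vert K) \<alpha>)"
    and hcmp_right: "\<alpha> \<in> Arr (vert K) \<Longrightarrow>
      HCmp K \<alpha> (Idn (vert K) (Idn (cells1 K) (dom0 K \<alpha>))) = \<alpha>"
    and hcmp_left: "\<alpha> \<in> Arr (vert K) \<Longrightarrow>
      HCmp K (Idn (vert K) (Idn (cells1 K) (cod0 K \<alpha>))) \<alpha> = \<alpha>"
    and hcmp_assoc: "\<lbrakk>\<alpha> \<in> Arr (vert K); \<beta> \<in> Arr (vert K); \<gamma> \<in> Arr (vert K);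
        cod0 K \<alpha> = dom0 K \<beta>; cod0 K \<beta> = dom0 K \<gamma>\<rbrakk> \<Longrightarrow>
      HCmp K \<gamma> (HCmp K \<beta> \<alpha>) = HCmp K (HCmp K \<gamma> \<beta>) \<alpha>"
    and hcmp_idn: "\<lbrakk>f \<in> Arr (cells1 K); g \<in> Arr (cells1 K);
        Cod (cells1 K) f = Dom (cells1 K) g\<rbrakk> \<Longrightarrow>
      HCmp K (Idn (vert K) g) (Idn (vert K) f) = Idn (vert K) (Cmp (cells1 K) g f)"
    and interchange: "\<lbrakk>\<alpha> \<in> Arr (vert K); \<alpha>' \<in> Arr (vert K); \<beta> \<in> Arr (vert K); \<beta>' \<in> Arr (vert K);
        Cod (vert K) \<alpha> = Dom (vert K) \<alpha>'; Cod (vert K) \<beta> = Dom (vert K) \<beta>';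
        cod0 K \<alpha> = dom0 K \<beta>\<rbrakk> \<Longrightarrow>
      HCmp K (Cmp (vert K) \<beta>' \<beta>) (Cmp (vert K) \<alpha>' \<alpha>)
        = Cmp (vert K) (HCmp K \<beta>' \<alpha>') (HCmp K \<beta> \<alpha>)"

record ('o, 'a, 'b, 'p, 'c, 'd) two_functor_data =
  on0 :: "'o \<Rightarrow> 'p"
  on1 :: "'a \<Rightarrow> 'c"
  on2 :: "'b \<Rightarrow> 'd"

locale strict_two_functor = K: two_category K + L: two_category L
  for K :: "('o, 'a, 'b) two_cat" and L :: "('p, 'c, 'd) two_cat" +
  fixes F :: "('o, 'a, 'b, 'p, 'c, 'd) two_functor_data"
  assumes ext0: "on0 F \<in> extensional (Obj (cells1 K))"
    and ext1: "on1 F \<in> extensional (Arr (cells1 K))"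
    and ext2: "on2 F \<in> extensional (Arr (vert K))"
    and functor1: "cat_functor (cells1 K) (cells1 L) \<lparr>on_obj = on0 F, on_arr = on1 F\<rparr>"
    and functor2: "cat_functor (vert K) (vert L) \<lparr>on_obj = on1 F, on_arr = on2 F\<rparr>"
    and on_hcmp: "\<lbrakk>\<alpha> \<in> Arr (vert K); \<beta> \<in> Arr (vert K); cod0 K \<alpha> = dom0 K \<beta>\<rbrakk> \<Longrightarrow>
      on2 F (HCmp K \<beta> \<alpha>) = HCmp L (on2 F \<beta>) (on2 F \<alpha>)"

text \<open>\<open>two_functor_comp K G F\<close> is \<open>G\<close> after \<open>F\<close>, where \<open>F\<close> starts at \<open>K\<close>.\<close>

definition two_functor_comp :: "('o, 'a, 'b) two_cat \<Rightarrow>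
    ('p, 'c, 'd, 'q, 'e, 'f) two_functor_data \<Rightarrow> ('o, 'a, 'b, 'p, 'c, 'd) two_functor_data \<Rightarrow>
    ('o, 'a, 'b, 'q, 'e, 'f) two_functor_data" where
  "two_functor_comp K G F =
    \<lparr>on0 = compose (Obj (cells1 K)) (on0 G) (on0 F),
     on1 = compose (Arr (cells1 K)) (on1 G) (on1 F),
     on2 = compose (Arr (vert K)) (on2 G) (on2 F)\<rparr>"

locale strict_transformation = F: strict_two_functor K L F + G: strict_two_functor K L G
  for K :: "('o, 'a, 'b) two_cat" and L :: "('p, 'c, 'd) two_cat"
    and F :: "('o, 'a, 'b, 'p, 'c, 'd) two_functor_data"
    and G :: "('o, 'a, 'b, 'p, 'c, 'd) two_functor_data" +
  fixes N :: "'o \<Rightarrow> 'c"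
  assumes ext: "N \<in> extensional (Obj (cells1 K))"
    and component: "x \<in> Obj (cells1 K) \<Longrightarrow> N x \<in> Arr (cells1 L) \<and>
      Dom (cells1 L) (N x) = on0 F x \<and> Cod (cells1 L) (N x) = on0 G x"
    and natural1: "f \<in> Arr (cells1 K) \<Longrightarrow>
      Cmp (cells1 L) (N (Cod (cells1 K) f)) (on1 F f)
        = Cmp (cells1 L) (on1 G f) (N (Dom (cells1 K) f))"
    and natural2: "\<alpha> \<in> Arr (vert K) \<Longrightarrow>
      HCmp L (Idn (vert L) (N (cod0 K \<alpha>))) (on2 F \<alpha>)
        = HCmp L (on2 G \<alpha>) (Idn (vert L) (N (dom0 K \<alpha>)))"

section \<open>Crossed modules\<close>

definition ext_group :: "'u monoid \<Rightarrow> bool" where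
  "ext_group G \<longleftrightarrow> group G \<and>
    (\<forall>x y. x \<notin> carrier G \<or> y \<notin> carrier G \<longrightarrow> x \<otimes>\<^bsub>G\<^esub> y = undefined)"

definition ext_hom :: "'u monoid \<Rightarrow> 'v monoid \<Rightarrow> ('u \<Rightarrow> 'v) set" where
  "ext_hom G H = hom G H \<inter> extensional (carrier G)"

text \<open>
  The actions of \<open>G\<close> on \<open>T\<close> by group automorphisms; the elements of \<^const>\<open>AutoGroup\<close> are extensional
  by definition.
\<close>

definition group_acts :: "'u monoid \<Rightarrow> 'v monoid \<Rightarrow> ('u \<Rightarrow> 'v \<Rightarrow> 'v) set" where
  "group_acts G T = hom G (AutoGroup T) \<inter> extensional (carrier G)"

record 'u xmod =
  top_group :: "'u monoid"
  base_group :: "'u monoid"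
  boundary :: "'u \<Rightarrow> 'u"
  xm_act :: "'u \<Rightarrow> 'u \<Rightarrow> 'u"  \<comment> \<open>\<open>xm_act X x t\<close> is \<open>t\<close> acted upon by \<open>x\<close>\<close>

definition crossed_module :: "'u xmod \<Rightarrow> bool" where
  "crossed_module X \<longleftrightarrow> (let T = top_group X; G = base_group X; \<delta> = boundary X; act = xm_act X in
    ext_group T \<and> ext_group G \<and> \<delta> \<in> ext_hom T G \<and> act \<in> group_acts G T \<and>
    (\<forall>x\<in>carrier G. \<forall>t\<in>carrier T. \<delta> (act x t) = x \<otimes>\<^bsub>G\<^esub> \<delta> t \<otimes>\<^bsub>G\<^esub> inv\<^bsub>G\<^esub> x) \<and>
    (\<forall>t\<in>carrier T. \<forall>t'\<in>carrier T. act (\<delta> t) t' = t \<otimes>\<^bsub>T\<^esub> t' \<otimes>\<^bsub>T\<^esub> inv\<^bsub>T\<^esub> t))"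

record 'u xmor =
  xdom :: "'u xmod"
  xcod :: "'u xmod"
  mor_top :: "'u \<Rightarrow> 'u"
  mor_base :: "'u \<Rightarrow> 'u"

definition crossed_module_mor :: "'u xmor \<Rightarrow> bool" where
  "crossed_module_mor f \<longleftrightarrow> (let X = xdom f; Y = xcod f in
    crossed_module X \<and> crossed_module Y \<and>
    mor_top f \<in> ext_hom (top_group X) (top_group Y) \<and>
    mor_base f \<in> ext_hom (base_group X) (base_group Y) \<and>
    (\<forall>t\<in>carrier (top_group X). boundary Y (mor_top f t) = mor_base f (boundary X t)) \<and>
    (\<forall>x\<in>carrier (base_group X). \<forall>t\<in>carrier (top_group X).
      mor_top f (xm_act X x t) = xm_act Y (mor_base f x) (mor_top f t)))"

definition XMod :: "('u xmod, 'u xmor) cat" where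
  "XMod =
    \<lparr>Obj = Collect crossed_module,
     Arr = Collect crossed_module_mor,
     Dom = xdom,
     Cod = xcod,
     Idn = (\<lambda>X. \<lparr>xdom = X, xcod = X,
       mor_top = (\<lambda>t\<in>carrier (top_group X). t), mor_base = (\<lambda>x\<in>carrier (base_group X). x)\<rparr>),
     Cmp = (\<lambda>g f. \<lparr>xdom = xdom f, xcod = xcod g,
       mor_top = compose (carrier (top_group (xdom f))) (mor_top g) (mor_top f),
       mor_base = compose (carrier (base_group (xdom f))) (mor_base g) (mor_base f)\<rparr>)\<rparr>"

text \<open>The map underlying a 2-cell does not determine its source, hence the fields \<open>cdom\<close> and \<open>ccod\<close>.\<close>

record 'u xcell =
  cdom :: "'u xmor"
  ccod :: "'u xmor"
  cmap :: "'u \<Rightarrow> 'u"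

definition crossed_module_cell :: "'u xcell \<Rightarrow> bool" where
  "crossed_module_cell \<alpha> \<longleftrightarrow> (let f = cdom \<alpha>; f' = ccod \<alpha>; a = cmap \<alpha>; X = xdom f; Y = xcod f in
    crossed_module_mor f \<and> crossed_module_mor f' \<and> xdom f' = X \<and> xcod f' = Y \<and>
    a \<in> (carrier (base_group X) \<rightarrow>\<^sub>E carrier (top_group Y)) \<and>
    (\<forall>x\<in>carrier (base_group X).
      mor_base f' x = boundary Y (a x) \<otimes>\<^bsub>base_group Y\<^esub> mor_base f x) \<and>
    (\<forall>t\<in>carrier (top_group X).
      mor_top f' t = a (boundary X t) \<otimes>\<^bsub>top_group Y\<^esub> mor_top f t) \<and>
    (\<forall>x\<in>carrier (base_group X). \<forall>x'\<in>carrier (base_group X).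
      a (x \<otimes>\<^bsub>base_group X\<^esub> x') = a x \<otimes>\<^bsub>top_group Y\<^esub> xm_act Y (mor_base f x) (a x')))"

definition XMod2 :: "('u xmod, 'u xmor, 'u xcell) two_cat" where
  "XMod2 =
    \<lparr>cells1 = XMod,
     vert =
       \<lparr>Obj = Arr XMod,
        Arr = Collect crossed_module_cell,
        Dom = cdom,
        Cod = ccod,
        Idn = (\<lambda>f. \<lparr>cdom = f, ccod = f,
          cmap = (\<lambda>x\<in>carrier (base_group (xdom f)). \<one>\<^bsub>top_group (xcod f)\<^esub>)\<rparr>),
        Cmp = (\<lambda>\<beta> \<alpha>. \<lparr>cdom = cdom \<alpha>, ccod = ccod \<beta>,
          cmap = (\<lambda>x\<in>carrier (base_group (xdom (cdom \<alpha>))).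
            cmap \<beta> x \<otimes>\<^bsub>top_group (xcod (cdom \<alpha>))\<^esub> cmap \<alpha> x)\<rparr>)\<rparr>,
     HCmp = (\<lambda>\<beta> \<alpha>.
       \<lparr>cdom = Cmp XMod (cdom \<beta>) (cdom \<alpha>), ccod = Cmp XMod (ccod \<beta>) (ccod \<alpha>),
        cmap = (\<lambda>x\<in>carrier (base_group (xdom (cdom \<alpha>))).
          cmap \<beta> (mor_base (ccod \<alpha>) x) \<otimes>\<^bsub>top_group (xcod (cdom \<beta>))\<^esub> mor_top (cdom \<beta>) (cmap \<alpha> x))\<rparr>)\<rparr>"

section \<open>The 2-category of a crossed module\<close>

definition two_cat_of :: "'u xmod \<Rightarrow> (unit, 'u, 'u \<times> 'u) two_cat" where
  "two_cat_of X = (let M = top_group X; P = base_group X; \<mu> = boundary X in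
    \<lparr>cells1 =
       \<lparr>Obj = {()}, Arr = carrier P, Dom = (\<lambda>_. ()), Cod = (\<lambda>_. ()), Idn = (\<lambda>_. \<one>\<^bsub>P\<^esub>), Cmp = mult P\<rparr>,
     vert =
       \<lparr>Obj = carrier P,
        Arr = carrier M \<times> carrier P,
        Dom = snd,
        Cod = (\<lambda>(m, p). \<mu> m \<otimes>\<^bsub>P\<^esub> p),
        Idn = (\<lambda>p. (\<one>\<^bsub>M\<^esub>, p)),
        Cmp = (\<lambda>(m2, p2) (m1, p1). (m2 \<otimes>\<^bsub>M\<^esub> m1, p1))\<rparr>,
     HCmp = (\<lambda>(m', p') (m, p). (m' \<otimes>\<^bsub>M\<^esub> xm_act X p' m, p' \<otimes>\<^bsub>P\<^esub> p))\<rparr>)"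

definition induced_two_functor ::
    "'u xmor \<Rightarrow> (unit, 'u, 'u \<times> 'u, unit, 'u, 'u \<times> 'u) two_functor_data" where
  "induced_two_functor a =
    \<lparr>on0 = (\<lambda>_. ()),
     on1 = (\<lambda>p\<in>carrier (base_group (xdom a)). mor_base a p),
     on2 = (\<lambda>(m, p)\<in>carrier (top_group (xdom a)) \<times> carrier (base_group (xdom a)).
       (mor_top a m, mor_base a p))\<rparr>"

section \<open>Actions of crossed modules\<close>

record 'u xaction =
  act_functor :: "(unit, 'u, 'u \<times> 'u, 'u xmod, 'u xmor, 'u xcell) two_functor_data"
  actor :: "'u xmod"

definition crossed_module_action :: "'u xaction \<Rightarrow> bool" where
  "crossed_module_action A \<longleftrightarrow> crossed_module (actor A) \<and>
    strict_two_functor (two_cat_of (actor A)) XMod2 (act_functor A)"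

record 'u xaction_mor =
  adom :: "'u xaction"
  acod :: "'u xaction"
  act_trans :: "unit \<Rightarrow> 'u xmor"
  actor_mor :: "'u xmor"

definition crossed_module_action_mor :: "'u xaction_mor \<Rightarrow> bool" where
  "crossed_module_action_mor n \<longleftrightarrow>
    crossed_module_action (adom n) \<and> crossed_module_action (acod n) \<and>
    actor_mor n \<in> Arr XMod \<and>
    Dom XMod (actor_mor n) = actor (adom n) \<and> Cod XMod (actor_mor n) = actor (acod n) \<and>
    strict_transformation (two_cat_of (actor (adom n))) XMod2
      (act_functor (adom n))
      (two_functor_comp (two_cat_of (actor (adom n)))
        (act_functor (acod n)) (induced_two_functor (actor_mor n)))
      (act_trans n)"

definition XAct :: "('u xaction, 'u xaction_mor) cat" where
  "XAct =
    \<lparr>Obj = Collect crossed_module_action,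
     Arr = Collect crossed_module_action_mor,
     Dom = adom,
     Cod = acod,
     Idn = (\<lambda>A. \<lparr>adom = A, acod = A,
       act_trans = (\<lambda>z. Idn XMod (on0 (act_functor A) z)),
       actor_mor = Idn XMod (actor A)\<rparr>),
     Cmp = (\<lambda>n' n. \<lparr>adom = adom n, acod = acod n',
       act_trans = (\<lambda>z. Cmp XMod (act_trans n' z) (act_trans n z)),
       actor_mor = Cmp XMod (actor_mor n') (actor_mor n)\<rparr>)\<rparr>"

definition conj_mor :: "'u xmod \<Rightarrow> 'u \<Rightarrow> 'u xmor" where
  "conj_mor X p = (let P = base_group X in
    \<lparr>xdom = X, xcod = X,
     mor_top = (\<lambda>m\<in>carrier (top_group X). xm_act X p m),
     mor_base = (\<lambda>p'\<in>carrier P. p \<otimes>\<^bsub>P\<^esub> p' \<otimes>\<^bsub>P\<^esub> inv\<^bsub>P\<^esub> p)\<rparr>)"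

definition conj_cell :: "'u xmod \<Rightarrow> 'u \<Rightarrow> 'u \<Rightarrow> 'u xcell" where
  "conj_cell X m p = (let M = top_group X; P = base_group X in
    \<lparr>cdom = conj_mor X p,
     ccod = conj_mor X (boundary X m \<otimes>\<^bsub>P\<^esub> p),
     cmap = compose (carrier P)
       (\<lambda>p'. m \<otimes>\<^bsub>M\<^esub> xm_act X p' (inv\<^bsub>M\<^esub> m)) (mor_base (conj_mor X p))\<rparr>)"

definition conj_action :: "'u xmod \<Rightarrow> 'u xaction" where
  "conj_action X =
    \<lparr>act_functor =
       \<lparr>on0 = (\<lambda>_. X),
        on1 = (\<lambda>p\<in>carrier (base_group X). conj_mor X p),
        on2 = (\<lambda>(m, p)\<in>carrier (top_group X) \<times> carrier (base_group X). conj_cell X m p)\<rparr>,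
     actor = X\<rparr>"

definition functor_I :: "('u xaction, 'u xaction_mor, 'u xmod, 'u xmor) functor_data" where
  "functor_I = \<lparr>on_obj = actor, on_arr = actor_mor\<rparr>"

definition functor_J :: "('u xaction, 'u xaction_mor, 'u xmod, 'u xmor) functor_data" where
  "functor_J = \<lparr>on_obj = (\<lambda>A. on0 (act_functor A) ()), on_arr = (\<lambda>n. act_trans n ())\<rparr>"

definition functor_R :: "('u xmod, 'u xmor, 'u xaction, 'u xaction_mor) functor_data" where
  "functor_R = \<lparr>on_obj = conj_action,
    on_arr = (\<lambda>a. \<lparr>adom = conj_action (xdom a), acod = conj_action (xcod a),
      act_trans = (\<lambda>_. a), actor_mor = a\<rparr>)\<rparr>"

section \<open>Whitehead sequences\<close>

record ('o, 'a) whitehead =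
  wobj :: 'o
  wu :: 'a
  wv :: 'a

record ('o, 'a) whitehead_mor =
  wdom :: "('o, 'a) whitehead"
  wcod :: "('o, 'a) whitehead"
  warr :: 'a

definition whitehead_sequence :: "('o, 'a) cat \<Rightarrow> ('p, 'b) cat \<Rightarrow>
    ('o, 'a, 'p, 'b) functor_data \<Rightarrow> ('p, 'b, 'o, 'a) functor_data \<Rightarrow>
    ('o, 'a, 'p, 'b) functor_data \<Rightarrow> ('o, 'a) whitehead \<Rightarrow> bool" where
  "whitehead_sequence C D I R J w \<longleftrightarrow> (let A = wobj w; u = wu w; v = wv w in
    A \<in> Obj C \<and>
    u \<in> Arr C \<and> Dom C u = A \<and> Cod C u = on_obj R (on_obj I A) \<and>
    v \<in> Arr C \<and> Dom C v = on_obj R (on_obj J A) \<and> Cod C v = A \<and>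
    on_arr I u = Idn D (on_obj I A) \<and>
    on_arr J v = Idn D (on_obj J A) \<and>
    on_arr I v = on_arr J u)"

definition whitehead_sequence_mor :: "('o, 'a) cat \<Rightarrow> ('p, 'b) cat \<Rightarrow>
    ('o, 'a, 'p, 'b) functor_data \<Rightarrow> ('p, 'b, 'o, 'a) functor_data \<Rightarrow>
    ('o, 'a, 'p, 'b) functor_data \<Rightarrow> ('o, 'a) whitehead_mor \<Rightarrow> bool" where
  "whitehead_sequence_mor C D I R J k \<longleftrightarrow> (let w1 = wdom k; w2 = wcod k; n = warr k in
    whitehead_sequence C D I R J w1 \<and> whitehead_sequence C D I R J w2 \<and>
    n \<in> Arr C \<and> Dom C n = wobj w1 \<and> Cod C n = wobj w2 \<and>
    Cmp C n (wv w1) = Cmp C (wv w2) (on_arr R (on_arr J n)) \<and>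
    Cmp C (wu w2) n = Cmp C (on_arr R (on_arr I n)) (wu w1))"

definition whitehead_category :: "('o, 'a) cat \<Rightarrow> ('p, 'b) cat \<Rightarrow>
    ('o, 'a, 'p, 'b) functor_data \<Rightarrow> ('p, 'b, 'o, 'a) functor_data \<Rightarrow>
    ('o, 'a, 'p, 'b) functor_data \<Rightarrow> (('o, 'a) whitehead, ('o, 'a) whitehead_mor) cat" where
  "whitehead_category C D I R J =
    \<lparr>Obj = Collect (whitehead_sequence C D I R J),
     Arr = Collect (whitehead_sequence_mor C D I R J),
     Dom = wdom,
     Cod = wcod,
     Idn = (\<lambda>w. \<lparr>wdom = w, wcod = w, warr = Idn C (wobj w)\<rparr>),
     Cmp = (\<lambda>k' k. \<lparr>wdom = wdom k, wcod = wcod k', warr = Cmp C (warr k') (warr k)\<rparr>)\<rparr>"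

type_synonym 'u wseq = "('u xaction, 'u xaction_mor) whitehead"
type_synonym 'u wseq_mor = "('u xaction, 'u xaction_mor) whitehead_mor"

definition WSeq :: "('u wseq, 'u wseq_mor) cat" where
  "WSeq = whitehead_category XAct XMod functor_I functor_R functor_J"

section \<open>Crossed squares\<close>

record 'u xsq =
  sqT :: "'u monoid"
  sqM :: "'u monoid"
  sqG :: "'u monoid"
  sqP :: "'u monoid"
  sq_f :: "'u \<Rightarrow> 'u"
  sq_d :: "'u \<Rightarrow> 'u"
  sq_mu :: "'u \<Rightarrow> 'u"
  sq_g :: "'u \<Rightarrow> 'u"
  actT :: "'u \<Rightarrow> 'u \<Rightarrow> 'u"
  actM :: "'u \<Rightarrow> 'u \<Rightarrow> 'u"
  actG :: "'u \<Rightarrow> 'u \<Rightarrow> 'u"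
  sq_phi :: "'u \<times> 'u \<Rightarrow> 'u"

definition crossed_square :: "'u xsq \<Rightarrow> bool" where
  "crossed_square S \<longleftrightarrow>
    (let T = sqT S; M = sqM S; G = sqG S; P = sqP S;
         f = sq_f S; \<delta> = sq_d S; \<mu> = sq_mu S; g = sq_g S;
         aT = actT S; aM = actM S; aG = actG S; \<phi> = sq_phi S in
    ext_group T \<and> ext_group M \<and> ext_group G \<and> ext_group P \<and>
    f \<in> ext_hom T M \<and> \<delta> \<in> ext_hom T G \<and> \<mu> \<in> ext_hom M P \<and> g \<in> ext_hom G P \<and>
    (\<forall>t\<in>carrier T. \<mu> (f t) = g (\<delta> t)) \<and>
    aT \<in> group_acts P T \<and> aM \<in> group_acts P M \<and> aG \<in> group_acts P G \<and>
    \<phi> \<in> (carrier M \<times> carrier G \<rightarrow>\<^sub>E carrier T) \<and>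
    (\<forall>p\<in>carrier P. \<forall>t\<in>carrier T. f (aT p t) = aM p (f t)) \<and>
    (\<forall>p\<in>carrier P. \<forall>t\<in>carrier T. \<delta> (aT p t) = aG p (\<delta> t)) \<and>
    crossed_module \<lparr>top_group = M, base_group = P, boundary = \<mu>, xm_act = aM\<rparr> \<and>
    crossed_module \<lparr>top_group = G, base_group = P, boundary = g, xm_act = aG\<rparr> \<and>
    crossed_module \<lparr>top_group = T, base_group = P, boundary = compose (carrier T) \<mu> f, xm_act = aT\<rparr> \<and>
    (\<forall>m\<in>carrier M. \<forall>x\<in>carrier G. f (\<phi> (m, x)) = m \<otimes>\<^bsub>M\<^esub> aM (g x) (inv\<^bsub>M\<^esub> m)) \<and>
    (\<forall>m\<in>carrier M. \<forall>x\<in>carrier G. \<delta> (\<phi> (m, x)) = aG (\<mu> m) x \<otimes>\<^bsub>G\<^esub> inv\<^bsub>G\<^esub> x) \<and>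
    (\<forall>t\<in>carrier T. \<forall>x\<in>carrier G. \<phi> (f t, x) = t \<otimes>\<^bsub>T\<^esub> aT (g x) (inv\<^bsub>T\<^esub> t)) \<and>
    (\<forall>m\<in>carrier M. \<forall>t\<in>carrier T. \<phi> (m, \<delta> t) = aT (\<mu> m) t \<otimes>\<^bsub>T\<^esub> inv\<^bsub>T\<^esub> t) \<and>
    (\<forall>m0\<in>carrier M. \<forall>m1\<in>carrier M. \<forall>x\<in>carrier G.
      \<phi> (m0 \<otimes>\<^bsub>M\<^esub> m1, x) = aT (\<mu> m0) (\<phi> (m1, x)) \<otimes>\<^bsub>T\<^esub> \<phi> (m0, x)) \<and>
    (\<forall>m\<in>carrier M. \<forall>x0\<in>carrier G. \<forall>x1\<in>carrier G.
      \<phi> (m, x0 \<otimes>\<^bsub>G\<^esub> x1) = \<phi> (m, x0) \<otimes>\<^bsub>T\<^esub> aT (g x0) (\<phi> (m, x1))) \<and>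
    (\<forall>p\<in>carrier P. \<forall>m\<in>carrier M. \<forall>x\<in>carrier G. aT p (\<phi> (m, x)) = \<phi> (aM p m, aG p x)))"

record 'u xsq_mor =
  sdom :: "'u xsq"
  scod :: "'u xsq"
  morT :: "'u \<Rightarrow> 'u"
  morM :: "'u \<Rightarrow> 'u"
  morG :: "'u \<Rightarrow> 'u"
  morP :: "'u \<Rightarrow> 'u"

definition crossed_square_mor :: "'u xsq_mor \<Rightarrow> bool" where
  "crossed_square_mor h \<longleftrightarrow>
    (let S1 = sdom h; S2 = scod h; hT = morT h; hM = morM h; hG = morG h; hP = morP h in
    crossed_square S1 \<and> crossed_square S2 \<and>
    hT \<in> ext_hom (sqT S1) (sqT S2) \<and> hM \<in> ext_hom (sqM S1) (sqM S2) \<and>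
    hG \<in> ext_hom (sqG S1) (sqG S2) \<and> hP \<in> ext_hom (sqP S1) (sqP S2) \<and>
    (\<forall>t\<in>carrier (sqT S1). sq_f S2 (hT t) = hM (sq_f S1 t)) \<and>
    (\<forall>t\<in>carrier (sqT S1). sq_d S2 (hT t) = hG (sq_d S1 t)) \<and>
    (\<forall>m\<in>carrier (sqM S1). sq_mu S2 (hM m) = hP (sq_mu S1 m)) \<and>
    (\<forall>x\<in>carrier (sqG S1). sq_g S2 (hG x) = hP (sq_g S1 x)) \<and>
    (\<forall>p\<in>carrier (sqP S1). \<forall>t\<in>carrier (sqT S1). hT (actT S1 p t) = actT S2 (hP p) (hT t)) \<and>
    (\<forall>p\<in>carrier (sqP S1). \<forall>m\<in>carrier (sqM S1). hM (actM S1 p m) = actM S2 (hP p) (hM m)) \<and>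
    (\<forall>p\<in>carrier (sqP S1). \<forall>x\<in>carrier (sqG S1). hG (actG S1 p x) = actG S2 (hP p) (hG x)) \<and>
    (\<forall>m\<in>carrier (sqM S1). \<forall>x\<in>carrier (sqG S1).
      hT (sq_phi S1 (m, x)) = sq_phi S2 (hM m, hG x)))"

definition XSq :: "('u xsq, 'u xsq_mor) cat" where
  "XSq =
    \<lparr>Obj = Collect crossed_square,
     Arr = Collect crossed_square_mor,
     Dom = sdom,
     Cod = scod,
     Idn = (\<lambda>S. \<lparr>sdom = S, scod = S,
       morT = (\<lambda>t\<in>carrier (sqT S). t), morM = (\<lambda>m\<in>carrier (sqM S). m),
       morG = (\<lambda>x\<in>carrier (sqG S). x), morP = (\<lambda>p\<in>carrier (sqP S). p)\<rparr>),
     Cmp = (\<lambda>k h. \<lparr>sdom = sdom h, scod = scod k,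
       morT = compose (carrier (sqT (sdom h))) (morT k) (morT h),
       morM = compose (carrier (sqM (sdom h))) (morM k) (morM h),
       morG = compose (carrier (sqG (sdom h))) (morG k) (morG h),
       morP = compose (carrier (sqP (sdom h))) (morP k) (morP h)\<rparr>)\<rparr>"

end

theory Submission
  imports Defs
begin

text \<open>
  An action of a crossed module \<open>B = (M, P, \<mu>)\<close> on \<open>E = (T, G, \<partial>)\<close> is determined by the actions
  \<open>\<theta>\<close> and \<open>\<sigma>\<close> of \<open>P\<close> on \<open>T\<close> and \<open>G\<close> and by the map \<open>\<phi>(m, x) = X\<^sub>\<circ>(m, 1)(x)\<close>, because
  \<open>(m, p) = (m, 1) * (1, p)\<close> forces \<open>X\<^sub>\<circ>(m, p)(x) = \<phi>(m, \<sigma>\<^sub>p x)\<close>. In terms of these data, being a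
  2-functor amounts to the axioms (4), (6), (7), (9) of a crossed square, equivariance of \<open>\<partial>\<close>, and (8)
  with \<open>G\<close> acting on \<open>T\<close> as in \<open>E\<close>. In a Whitehead sequence \<open>I(v) = J(u)\<close> is a morphism
  \<open>n = (f, g) : E \<rightarrow> B\<close>. That \<open>u\<close> is a morphism of actions gives the equivariance of \<open>f\<close> and \<open>g\<close>
  and (3); that \<open>v\<close> is one says that \<open>x \<in> G\<close> acts on \<open>T\<close> as \<open>\<theta>\<close> and on \<open>G\<close>, by conjugation, as
  \<open>\<sigma>\<close> at \<open>g(x)\<close>, together with (5).
\<close>

section \<open>Crossed modules, their morphisms and 2-cells\<close>

text \<open>An isomorphism of categories asks for equality of records, so every passage below has to
  recover the original record exactly: agreement on carriers becomes equality by extensionality, and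
  a function on \<open>unit\<close> is determined by one value. A crossed square carries no action
  of G on T of its own. It is rebuilt as the action through g, and on the other side
  \<open>v\<close> forces the action of \<open>E\<close> to be this one, so nothing is lost in
  either direction. The same fact turns (8) for \<open>E\<close> into (8) for the square. Axiom (7)
  does not come out of a 2-functor in the stated form: vertical composition yields \<phi>(m n, x) =
  \<phi>(m, \<sigma>(\<mu> n) x) \<phi>(n, x). The Peiffer identity of \<open>E\<close>, with (4),
  (6) and (8), converts one form into the other. Identities and composites are compared in one
  direction only: on the way from squares to sequences both sides unfold to the same record. The
  category laws for sequences and functoriality of the inverse then follow from bijectivity.\<close>

lemma (in group) inv_cancel [simp]:
  assumes "x \<in> carrier G" "y \<in> carrier G"
  shows "x \<otimes> (inv x \<otimes> y) = y" "inv x \<otimes> (x \<otimes> y) = y"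
  using assms by (simp_all flip: m_assoc)

text \<open>Bijectivity is automatic: by the composition and unit laws \<open>a (inv x)\<close> is a
  two-sided inverse of \<open>a x\<close>. Actions can thus be built and used through pointwise
  equations between endomorphisms, without \<open>AutoGroup\<close>.\<close>

lemma group_acts_iff:
  fixes G :: "'u monoid" and T :: "'v monoid"
  assumes "group G" "group T"
  shows "a \<in> group_acts G T \<longleftrightarrow> a \<in> extensional (carrier G) \<and>
    (\<forall>x\<in>carrier G. a x \<in> extensional (carrier T) \<and> a x \<in> hom T T) \<and>
    (\<forall>x\<in>carrier G. \<forall>y\<in>carrier G. \<forall>t\<in>carrier T. a (x \<otimes>\<^bsub>G\<^esub> y) t = a x (a y t)) \<and>
    (\<forall>t\<in>carrier T. a \<one>\<^bsub>G\<^esub> t = t)"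
    (is "?L \<longleftrightarrow> ?R")
proof
  interpret G: group G by fact
  interpret T: group T by fact
  interpret A: group "AutoGroup T" by (rule T.AutoGroup)
  assume L: ?L
  then have hom: "a \<in> hom G (AutoGroup T)" and ext: "a \<in> extensional (carrier G)"
    by (auto simp: group_acts_def)
  have auto: "a x \<in> hom T T \<and> a x \<in> Bij (carrier T)" if "x \<in> carrier G" for x
    using hom_in_carrier[OF hom that] by (auto simp: AutoGroup_def auto_def)
  have "a (x \<otimes>\<^bsub>G\<^esub> y) t = a x (a y t)"
    if "x \<in> carrier G" "y \<in> carrier G" "t \<in> carrier T" for x y t
    using hom_mult[OF hom that(1,2)] auto[OF that(1)] auto[OF that(2)] that(3)
    by (simp add: AutoGroup_def BijGroup_def compose_def)
  moreover have "a \<one>\<^bsub>G\<^esub> t = t" if "t \<in> carrier T" for t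
    using hom_one[OF hom G.is_group A.is_group] that by (simp add: AutoGroup_def BijGroup_def)
  ultimately show ?R
    using auto ext by (auto simp: Bij_def)
next
  interpret G: group G by fact
  interpret T: group T by fact
  assume R: ?R
  have cl: "a x t \<in> carrier T" if "x \<in> carrier G" "t \<in> carrier T" for x t
    using R that by (auto dest: hom_in_carrier)
  have bij: "a x \<in> Bij (carrier T)" if x: "x \<in> carrier G" for x
  proof -
    have "bij_betw (a x) (carrier T) (carrier T)"
    proof (rule bij_betwI)
      show "a x \<in> carrier T \<rightarrow> carrier T" "a (inv\<^bsub>G\<^esub> x) \<in> carrier T \<rightarrow> carrier T"
        using cl x by auto
      fix t assume t: "t \<in> carrier T"
      have "a (inv\<^bsub>G\<^esub> x) (a x t) = a (inv\<^bsub>G\<^esub> x \<otimes>\<^bsub>G\<^esub> x) t"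
        using R x t G.inv_closed[OF x] by metis
      then show "a (inv\<^bsub>G\<^esub> x) (a x t) = t"
        using R x t by simp
      have "a x (a (inv\<^bsub>G\<^esub> x) t) = a (x \<otimes>\<^bsub>G\<^esub> inv\<^bsub>G\<^esub> x) t"
        using R x t G.inv_closed[OF x] by metis
      then show "a x (a (inv\<^bsub>G\<^esub> x) t) = t"
        using R x t by simp
    qed
    then show ?thesis
      using R x by (simp add: Bij_def)
  qed
  \<comment> \<open>The product of \<open>AutoGroup T\<close> is \<open>compose\<close> on the
    carrier; extensionality lifts the pointwise law to this equality of functions.\<close>
  have "a (x \<otimes>\<^bsub>G\<^esub> y) = compose (carrier T) (a x) (a y)" if "x \<in> carrier G" "y \<in> carrier G" for x y
    using R that by (intro extensionalityI[of _ "carrier T"]) (auto simp: compose_def)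
  then show ?L
    using R bij
    by (auto simp: group_acts_def hom_def AutoGroup_def auto_def BijGroup_def)
qed

locale automorphism_action = G: group G + T: group T
  for G :: "'u monoid" and T :: "'v monoid" +
  fixes a :: "'u \<Rightarrow> 'v \<Rightarrow> 'v"
  assumes acts: "a \<in> group_acts G T"
begin

lemmas acts_unfolded = acts[unfolded group_acts_iff[OF G.is_group T.is_group]]

lemma ext: "a \<in> extensional (carrier G)"
  and ext2: "x \<in> carrier G \<Longrightarrow> a x \<in> extensional (carrier T)"
  using acts_unfolded by auto

lemma hom: "x \<in> carrier G \<Longrightarrow> group_hom T T (a x)"
  using acts_unfolded by unfold_locales auto

lemmas closed [simp] = group_hom.hom_closed[OF hom]
  and mult [simp] = group_hom.hom_mult[OF hom]
  and one [simp] = group_hom.hom_one[OF hom]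
  and inv [simp] = group_hom.hom_inv[OF hom]

text \<open>Not a simp rule, since it is needed in both directions: \<open>inv_cancel\<close> below
  reads it from right to left.\<close>

lemma comp: "\<lbrakk>x \<in> carrier G; y \<in> carrier G; t \<in> carrier T\<rbrakk> \<Longrightarrow> a (x \<otimes>\<^bsub>G\<^esub> y) t = a x (a y t)"
  using acts_unfolded by auto

lemma unit [simp]: "t \<in> carrier T \<Longrightarrow> a \<one>\<^bsub>G\<^esub> t = t"
  using acts_unfolded by auto

lemma inv_cancel [simp]:
  assumes "x \<in> carrier G" "t \<in> carrier T"
  shows "a x (a (inv\<^bsub>G\<^esub> x) t) = t" "a (inv\<^bsub>G\<^esub> x) (a x t) = t"
  using assms by (simp_all flip: comp)

end

lemma ext_groupD: "ext_group G \<Longrightarrow> group G"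
  by (simp add: ext_group_def)

locale xmodule =
  fixes X :: "'u xmod"
  assumes crossed_module: "crossed_module X"
begin

lemma ext_top: "ext_group (top_group X)" and ext_base: "ext_group (base_group X)"
  using crossed_module by (auto simp: crossed_module_def Let_def)

sublocale T: group "top_group X"
  by (rule ext_groupD[OF ext_top])

sublocale G: group "base_group X"
  by (rule ext_groupD[OF ext_base])

sublocale bd: group_hom "top_group X" "base_group X" "boundary X"
  using crossed_module
  by unfold_locales (auto simp: crossed_module_def Let_def ext_hom_def)

sublocale act: automorphism_action "base_group X" "top_group X" "xm_act X"
  using crossed_module by unfold_locales (auto simp: crossed_module_def Let_def)

lemma boundary_ext: "boundary X \<in> extensional (carrier (top_group X))"
  using crossed_module by (auto simp: crossed_module_def Let_def ext_hom_def)

lemma boundary_act [simp]: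
  "\<lbrakk>x \<in> carrier (base_group X); t \<in> carrier (top_group X)\<rbrakk> \<Longrightarrow>
    boundary X (xm_act X x t)
      = x \<otimes>\<^bsub>base_group X\<^esub> boundary X t \<otimes>\<^bsub>base_group X\<^esub> inv\<^bsub>base_group X\<^esub> x"
  using crossed_module by (auto simp: crossed_module_def Let_def)

lemma peiffer [simp]:
  "\<lbrakk>s \<in> carrier (top_group X); t \<in> carrier (top_group X)\<rbrakk> \<Longrightarrow>
    xm_act X (boundary X s) t = s \<otimes>\<^bsub>top_group X\<^esub> t \<otimes>\<^bsub>top_group X\<^esub> inv\<^bsub>top_group X\<^esub> s"
  using crossed_module by (auto simp: crossed_module_def Let_def)

end

text \<open>Source and target are parameters although \<open>f\<close> records them: rewriting
  \<open>xdom f\<close> and \<open>xcod f\<close> to these names lets morphisms with provably equal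
  endpoints be composed and compared.\<close>

locale xmodule_mor =
  fixes X Y :: "'u xmod" and f :: "'u xmor"
  assumes crossed_module_mor: "crossed_module_mor f"
    and xdom [simp]: "xdom f = X" and xcod [simp]: "xcod f = Y"
begin

sublocale X: xmodule X
  using crossed_module_mor by unfold_locales (simp add: crossed_module_mor_def Let_def)

sublocale Y: xmodule Y
  using crossed_module_mor by unfold_locales (simp add: crossed_module_mor_def Let_def)

sublocale top: group_hom "top_group X" "top_group Y" "mor_top f"
  using crossed_module_mor
  by unfold_locales (simp add: crossed_module_mor_def Let_def ext_hom_def)

sublocale base: group_hom "base_group X" "base_group Y" "mor_base f"
  using crossed_module_mor
  by unfold_locales (simp add: crossed_module_mor_def Let_def ext_hom_def)

lemma top_ext: "mor_top f \<in> extensional (carrier (top_group X))"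
  and base_ext: "mor_base f \<in> extensional (carrier (base_group X))"
  using crossed_module_mor by (auto simp: crossed_module_mor_def Let_def ext_hom_def)

text \<open>Used in both directions, hence no simp rule. Reversed, it moves a boundary out of
  \<open>mor_base f\<close>, so that the Peiffer identity of \<open>Y\<close> applies.\<close>

lemma boundary_top:
  "t \<in> carrier (top_group X) \<Longrightarrow> boundary Y (mor_top f t) = mor_base f (boundary X t)"
  using crossed_module_mor by (auto simp: crossed_module_mor_def Let_def)

lemma top_act [simp]:
  "\<lbrakk>x \<in> carrier (base_group X); t \<in> carrier (top_group X)\<rbrakk> \<Longrightarrow>
    mor_top f (xm_act X x t) = xm_act Y (mor_base f x) (mor_top f t)"
  using crossed_module_mor by (auto simp: crossed_module_mor_def Let_def)

end

lemma xmodule_mor_iff: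
  "xmodule_mor X Y f \<longleftrightarrow> crossed_module_mor f \<and> xdom f = X \<and> xcod f = Y"
  by (simp add: xmodule_mor_def)

locale xmodule_cell =
  fixes X Y :: "'u xmod" and f f' :: "'u xmor" and \<alpha> :: "'u xcell"
  assumes crossed_module_cell: "crossed_module_cell \<alpha>"
    and cdom [simp]: "cdom \<alpha> = f" and ccod [simp]: "ccod \<alpha> = f'"
    and source: "xdom f = X" and target: "xcod f = Y"
begin

sublocale f: xmodule_mor X Y f
  using crossed_module_cell source target
  by unfold_locales (auto simp: crossed_module_cell_def Let_def)

sublocale f': xmodule_mor X Y f'
  using crossed_module_cell source target
  by unfold_locales (auto simp: crossed_module_cell_def Let_def)

lemma cmap_closed [simp]:
  "x \<in> carrier (base_group X) \<Longrightarrow> cmap \<alpha> x \<in> carrier (top_group Y)"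
  using crossed_module_cell by (auto simp: crossed_module_cell_def Let_def)

lemma cmap_ext: "cmap \<alpha> \<in> extensional (carrier (base_group X))"
  using crossed_module_cell by (auto simp: crossed_module_cell_def Let_def PiE_def)

lemma base_eq:
  "x \<in> carrier (base_group X) \<Longrightarrow>
    mor_base f' x = boundary Y (cmap \<alpha> x) \<otimes>\<^bsub>base_group Y\<^esub> mor_base f x"
  using crossed_module_cell by (auto simp: crossed_module_cell_def Let_def)

lemma top_eq:
  "t \<in> carrier (top_group X) \<Longrightarrow>
    mor_top f' t = cmap \<alpha> (boundary X t) \<otimes>\<^bsub>top_group Y\<^esub> mor_top f t"
  using crossed_module_cell by (auto simp: crossed_module_cell_def Let_def)

lemma cocycle:
  "\<lbrakk>x \<in> carrier (base_group X); y \<in> carrier (base_group X)\<rbrakk> \<Longrightarrow>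
    cmap \<alpha> (x \<otimes>\<^bsub>base_group X\<^esub> y)
      = cmap \<alpha> x \<otimes>\<^bsub>top_group Y\<^esub> xm_act Y (mor_base f x) (cmap \<alpha> y)"
  using crossed_module_cell by (auto simp: crossed_module_cell_def Let_def)

end

lemma xmodule_cell_iff:
  "xmodule_cell X Y f f' \<alpha> \<longleftrightarrow>
    crossed_module_cell \<alpha> \<and> cdom \<alpha> = f \<and> ccod \<alpha> = f' \<and> xdom f = X \<and> xcod f = Y"
  by (simp add: xmodule_cell_def)

lemma xmodule_morI:
  assumes "crossed_module X" "crossed_module Y" "xdom f = X" "xcod f = Y"
    and "\<And>t. t \<in> carrier (top_group X) \<Longrightarrow> mor_top f t \<in> carrier (top_group Y)"
    and "\<And>s t. \<lbrakk>s \<in> carrier (top_group X); t \<in> carrier (top_group X)\<rbrakk> \<Longrightarrow>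
      mor_top f (s \<otimes>\<^bsub>top_group X\<^esub> t) = mor_top f s \<otimes>\<^bsub>top_group Y\<^esub> mor_top f t"
    and "mor_top f \<in> extensional (carrier (top_group X))"
    and "\<And>x. x \<in> carrier (base_group X) \<Longrightarrow> mor_base f x \<in> carrier (base_group Y)"
    and "\<And>x y. \<lbrakk>x \<in> carrier (base_group X); y \<in> carrier (base_group X)\<rbrakk> \<Longrightarrow>
      mor_base f (x \<otimes>\<^bsub>base_group X\<^esub> y) = mor_base f x \<otimes>\<^bsub>base_group Y\<^esub> mor_base f y"
    and "mor_base f \<in> extensional (carrier (base_group X))"
    and "\<And>t. t \<in> carrier (top_group X) \<Longrightarrow> boundary Y (mor_top f t) = mor_base f (boundary X t)"
    and "\<And>x t. \<lbrakk>x \<in> carrier (base_group X); t \<in> carrier (top_group X)\<rbrakk> \<Longrightarrow>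
      mor_top f (xm_act X x t) = xm_act Y (mor_base f x) (mor_top f t)"
  shows "xmodule_mor X Y f"
  using assms
  by (auto simp: xmodule_mor_iff crossed_module_mor_def Let_def ext_hom_def hom_def)

lemma xmodule_cellI:
  assumes "xmodule_mor X Y f" "xmodule_mor X Y f'" "cdom \<alpha> = f" "ccod \<alpha> = f'"
    and "\<And>x. x \<in> carrier (base_group X) \<Longrightarrow> cmap \<alpha> x \<in> carrier (top_group Y)"
    and "cmap \<alpha> \<in> extensional (carrier (base_group X))"
    and "\<And>x. x \<in> carrier (base_group X) \<Longrightarrow>
      mor_base f' x = boundary Y (cmap \<alpha> x) \<otimes>\<^bsub>base_group Y\<^esub> mor_base f x"
    and "\<And>t. t \<in> carrier (top_group X) \<Longrightarrow>
      mor_top f' t = cmap \<alpha> (boundary X t) \<otimes>\<^bsub>top_group Y\<^esub> mor_top f t"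
    and "\<And>x y. \<lbrakk>x \<in> carrier (base_group X); y \<in> carrier (base_group X)\<rbrakk> \<Longrightarrow>
      cmap \<alpha> (x \<otimes>\<^bsub>base_group X\<^esub> y)
        = cmap \<alpha> x \<otimes>\<^bsub>top_group Y\<^esub> xm_act Y (mor_base f x) (cmap \<alpha> y)"
  shows "xmodule_cell X Y f f' \<alpha>"
  using assms by (auto simp: xmodule_cell_iff xmodule_mor_iff crossed_module_cell_def Let_def PiE_def)

lemma xmor_eqI:
  assumes "xmodule_mor X Y f" "xmodule_mor X Y g"
    and "\<And>t. t \<in> carrier (top_group X) \<Longrightarrow> mor_top f t = mor_top g t"
    and "\<And>x. x \<in> carrier (base_group X) \<Longrightarrow> mor_base f x = mor_base g x"
  shows "f = g"
proof -
  interpret f: xmodule_mor X Y f by fact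
  interpret g: xmodule_mor X Y g by fact
  have "mor_top f = mor_top g"
    using extensionalityI[OF f.top_ext g.top_ext] assms by auto
  moreover have "mor_base f = mor_base g"
    using extensionalityI[OF f.base_ext g.base_ext] assms by auto
  ultimately show ?thesis by simp
qed

lemma xcell_eqI:
  assumes "xmodule_cell X Y f f' \<alpha>" "xmodule_cell X Y f f' \<beta>"
    and "\<And>x. x \<in> carrier (base_group X) \<Longrightarrow> cmap \<alpha> x = cmap \<beta> x"
  shows "\<alpha> = \<beta>"
proof -
  interpret f: xmodule_cell X Y f f' \<alpha> by fact
  interpret g: xmodule_cell X Y f f' \<beta> by fact
  have "cmap \<alpha> = cmap \<beta>"
    using extensionalityI[OF f.cmap_ext g.cmap_ext] assms by auto
  then show ?thesis by simp
qed

section \<open>The category of crossed modules\<close>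

lemma XMod_sel [simp]:
  "Obj XMod = Collect crossed_module" "Arr XMod = Collect crossed_module_mor"
  "Dom XMod = xdom" "Cod XMod = xcod"
  "xdom (Idn XMod X) = X" "xcod (Idn XMod X) = X"
  "mor_top (Idn XMod X) = (\<lambda>t\<in>carrier (top_group X). t)"
  "mor_base (Idn XMod X) = (\<lambda>x\<in>carrier (base_group X). x)"
  "xdom (Cmp XMod g f) = xdom f" "xcod (Cmp XMod g f) = xcod g"
  "mor_top (Cmp XMod g f) = compose (carrier (top_group (xdom f))) (mor_top g) (mor_top f)"
  "mor_base (Cmp XMod g f) = compose (carrier (base_group (xdom f))) (mor_base g) (mor_base f)"
  by (auto simp: XMod_def)

lemma xmodule_mor_Idn:
  assumes "crossed_module X"
  shows "xmodule_mor X X (Idn XMod X)"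
proof -
  interpret X: xmodule X using assms by unfold_locales
  show ?thesis using assms by (intro xmodule_morI) auto
qed

lemma xmodule_mor_Cmp:
  assumes "xmodule_mor X Y f" "xmodule_mor Y Z g"
  shows "xmodule_mor X Z (Cmp XMod g f)"
proof -
  interpret f: xmodule_mor X Y f by fact
  interpret g: xmodule_mor Y Z g by fact
  show ?thesis
    using f.X.crossed_module g.Y.crossed_module
    by (intro xmodule_morI) (auto simp: compose_eq g.boundary_top f.boundary_top)
qed

lemma XMod_Cmp_Idn_right:
  assumes "xmodule_mor X Y f"
  shows "Cmp XMod f (Idn XMod X) = f"
proof -
  interpret f: xmodule_mor X Y f by fact
  show ?thesis
    using assms xmodule_mor_Cmp[OF xmodule_mor_Idn[OF f.X.crossed_module] assms]
    by (intro xmor_eqI[of X Y]) (auto simp: compose_eq)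
qed

lemma XMod_Cmp_Idn_left:
  assumes "xmodule_mor X Y f"
  shows "Cmp XMod (Idn XMod Y) f = f"
proof -
  interpret f: xmodule_mor X Y f by fact
  show ?thesis
    using assms xmodule_mor_Cmp[OF assms xmodule_mor_Idn[OF f.Y.crossed_module]]
    by (intro xmor_eqI[of X Y]) (auto simp: compose_eq)
qed

lemma XMod_Cmp_assoc:
  assumes "xmodule_mor X Y f" "xmodule_mor Y Z g" "xmodule_mor Z W h"
  shows "Cmp XMod h (Cmp XMod g f) = Cmp XMod (Cmp XMod h g) f"
proof -
  interpret f: xmodule_mor X Y f by fact
  interpret g: xmodule_mor Y Z g by fact
  show ?thesis
    using xmodule_mor_Cmp[OF xmodule_mor_Cmp[OF assms(1,2)] assms(3)]
      xmodule_mor_Cmp[OF assms(1) xmodule_mor_Cmp[OF assms(2,3)]]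
    by (intro xmor_eqI[of X W]) (auto simp: compose_eq)
qed

lemma category_XMod: "category (XMod :: ('u xmod, 'u xmor) cat)"
proof
  fix f g h :: "'u xmor"
  assume "f \<in> Arr XMod"
  then have f: "xmodule_mor (xdom f) (xcod f) f" by (simp add: xmodule_mor_iff)
  show "Dom XMod f \<in> Obj XMod \<and> Cod XMod f \<in> Obj XMod"
    using f by (simp add: xmodule_mor_iff crossed_module_mor_def Let_def)
  show "Cmp XMod f (Idn XMod (Dom XMod f)) = f" "Cmp XMod (Idn XMod (Cod XMod f)) f = f"
    using XMod_Cmp_Idn_right[OF f] XMod_Cmp_Idn_left[OF f] by simp_all
  assume "g \<in> Arr XMod" "Cod XMod f = Dom XMod g"
  then have g: "xmodule_mor (xcod f) (xcod g) g" by (simp add: xmodule_mor_iff)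
  show "Cmp XMod g f \<in> Arr XMod \<and> Dom XMod (Cmp XMod g f) = Dom XMod f \<and>
      Cod XMod (Cmp XMod g f) = Cod XMod g"
    using xmodule_mor_Cmp[OF f g] by (simp add: xmodule_mor_iff)
  assume "h \<in> Arr XMod" "Cod XMod g = Dom XMod h"
  then have h: "xmodule_mor (xcod g) (xcod h) h" by (simp add: xmodule_mor_iff)
  show "Cmp XMod h (Cmp XMod g f) = Cmp XMod (Cmp XMod h g) f"
    using XMod_Cmp_assoc[OF f g h] .
next
  fix X :: "'u xmod"
  assume "X \<in> Obj XMod"
  then show "Idn XMod X \<in> Arr XMod \<and> Dom XMod (Idn XMod X) = X \<and> Cod XMod (Idn XMod X) = X"
    using xmodule_mor_Idn[of X] by (simp add: xmodule_mor_iff)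
qed

section \<open>The 2-category of crossed modules: 2-cells and their two compositions\<close>

lemma XMod2_sel [simp]:
  "cells1 XMod2 = XMod" "Obj (vert XMod2) = Arr XMod"
  "Arr (vert XMod2) = Collect crossed_module_cell" "Dom (vert XMod2) = cdom" "Cod (vert XMod2) = ccod"
  "cdom (Idn (vert XMod2) f) = f" "ccod (Idn (vert XMod2) f) = f"
  "cmap (Idn (vert XMod2) f) = (\<lambda>x\<in>carrier (base_group (xdom f)). \<one>\<^bsub>top_group (xcod f)\<^esub>)"
  "cdom (Cmp (vert XMod2) \<beta> \<alpha>) = cdom \<alpha>" "ccod (Cmp (vert XMod2) \<beta> \<alpha>) = ccod \<beta>"
  "cmap (Cmp (vert XMod2) \<beta> \<alpha>) = (\<lambda>x\<in>carrier (base_group (xdom (cdom \<alpha>))).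
    cmap \<beta> x \<otimes>\<^bsub>top_group (xcod (cdom \<alpha>))\<^esub> cmap \<alpha> x)"
  "cdom (HCmp XMod2 \<beta> \<alpha>) = Cmp XMod (cdom \<beta>) (cdom \<alpha>)"
  "ccod (HCmp XMod2 \<beta> \<alpha>) = Cmp XMod (ccod \<beta>) (ccod \<alpha>)"
  "cmap (HCmp XMod2 \<beta> \<alpha>) = (\<lambda>x\<in>carrier (base_group (xdom (cdom \<alpha>))).
    cmap \<beta> (mor_base (ccod \<alpha>) x) \<otimes>\<^bsub>top_group (xcod (cdom \<beta>))\<^esub> mor_top (cdom \<beta>) (cmap \<alpha> x))"
  "dom0 XMod2 \<alpha> = xdom (cdom \<alpha>)" "cod0 XMod2 \<alpha> = xcod (cdom \<alpha>)"
  by (auto simp: XMod2_def dom0_def cod0_def)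

lemma xmodule_cell_Idn:
  assumes "xmodule_mor X Y f"
  shows "xmodule_cell X Y f f (Idn (vert XMod2) f)"
proof -
  interpret f: xmodule_mor X Y f by fact
  show ?thesis using assms by (intro xmodule_cellI) auto
qed

text \<open>The cocycle law needs the Peiffer identity. Since f' x is \<partial>(\<alpha> x) times f
  x, acting by f' x on \<beta> y is acting by f x followed by conjugation with \<alpha> x, and the
  inverse of \<alpha> x cancels against the factor \<alpha> x that comes next.\<close>

lemma xmodule_cell_Cmp:
  assumes "xmodule_cell X Y f f' \<alpha>" "xmodule_cell X Y f' f'' \<beta>"
  shows "xmodule_cell X Y f f'' (Cmp (vert XMod2) \<beta> \<alpha>)"
proof -
  interpret a: xmodule_cell X Y f f' \<alpha> by fact
  interpret b: xmodule_cell X Y f' f'' \<beta> by fact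
  show ?thesis
    using a.f.xmodule_mor_axioms b.f'.xmodule_mor_axioms
    by (intro xmodule_cellI)
      (auto simp: a.base_eq b.base_eq a.top_eq b.top_eq a.cocycle b.cocycle a.f.Y.act.comp
        a.f.Y.T.m_assoc a.f.Y.G.m_assoc)
qed

text \<open>As for vertical composition, the cocycle law rests on the Peiffer identity: g (f' x)
  differs from g (f x) by the boundary of g (\<alpha> x), which is the local fact
  \<open>base\<close>.\<close>

lemma xmodule_cell_HCmp:
  assumes "xmodule_cell X Y f f' \<alpha>" "xmodule_cell Y Z g g' \<beta>"
  shows "xmodule_cell X Z (Cmp XMod g f) (Cmp XMod g' f') (HCmp XMod2 \<beta> \<alpha>)"
proof -
  interpret a: xmodule_cell X Y f f' \<alpha> by fact
  interpret b: xmodule_cell Y Z g g' \<beta> by fact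
  have base: "mor_base g (mor_base f' x)
      = boundary Z (mor_top g (cmap \<alpha> x)) \<otimes>\<^bsub>base_group Z\<^esub> mor_base g (mor_base f x)"
    if "x \<in> carrier (base_group X)" for x
    using that by (simp add: a.base_eq b.f.boundary_top)
  have top: "mor_top g' (mor_top f' t)
      = cmap \<beta> (mor_base f' (boundary X t)) \<otimes>\<^bsub>top_group Z\<^esub>
        (mor_top g (cmap \<alpha> (boundary X t)) \<otimes>\<^bsub>top_group Z\<^esub> mor_top g (mor_top f t))"
    if "t \<in> carrier (top_group X)" for t
  proof -
    \<comment> \<open>\<open>b.top_eq\<close> is applied to f' t as a whole, before f' t is
      expanded, so that the argument of \<beta> becomes f' (\<partial> t).\<close>
    have "mor_top g' (mor_top f' t)
        = cmap \<beta> (mor_base f' (boundary X t)) \<otimes>\<^bsub>top_group Z\<^esub> mor_top g (mor_top f' t)"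
      using that by (simp add: b.top_eq a.f'.boundary_top)
    then show ?thesis
      using that by (simp add: a.top_eq)
  qed
  show ?thesis
    using xmodule_mor_Cmp[OF a.f.xmodule_mor_axioms b.f.xmodule_mor_axioms]
      xmodule_mor_Cmp[OF a.f'.xmodule_mor_axioms b.f'.xmodule_mor_axioms]
    by (intro xmodule_cellI)
      (auto simp: compose_eq b.base_eq base top a.cocycle b.cocycle b.f.Y.act.comp
        b.f.Y.T.m_assoc b.f.Y.G.m_assoc)
qed

lemma XMod2_Cmp_Idn_right:
  assumes "xmodule_cell X Y f f' \<alpha>"
  shows "Cmp (vert XMod2) \<alpha> (Idn (vert XMod2) f) = \<alpha>"
proof -
  interpret a: xmodule_cell X Y f f' \<alpha> by fact
  show ?thesis
    using assms xmodule_cell_Cmp[OF xmodule_cell_Idn[OF a.f.xmodule_mor_axioms] assms]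
    by (intro xcell_eqI[of X Y f f']) auto
qed

lemma XMod2_Cmp_Idn_left:
  assumes "xmodule_cell X Y f f' \<alpha>"
  shows "Cmp (vert XMod2) (Idn (vert XMod2) f') \<alpha> = \<alpha>"
proof -
  interpret a: xmodule_cell X Y f f' \<alpha> by fact
  show ?thesis
    using assms xmodule_cell_Cmp[OF assms xmodule_cell_Idn[OF a.f'.xmodule_mor_axioms]]
    by (intro xcell_eqI[of X Y f f']) auto
qed

lemma XMod2_Cmp_assoc:
  assumes "xmodule_cell X Y f f' \<alpha>" "xmodule_cell X Y f' f'' \<beta>" "xmodule_cell X Y f'' h \<gamma>"
  shows "Cmp (vert XMod2) \<gamma> (Cmp (vert XMod2) \<beta> \<alpha>) = Cmp (vert XMod2) (Cmp (vert XMod2) \<gamma> \<beta>) \<alpha>"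
proof -
  interpret a: xmodule_cell X Y f f' \<alpha> by fact
  interpret b: xmodule_cell X Y f' f'' \<beta> by fact
  interpret c: xmodule_cell X Y f'' h \<gamma> by fact
  show ?thesis
    using xmodule_cell_Cmp[OF xmodule_cell_Cmp[OF assms(1,2)] assms(3)]
      xmodule_cell_Cmp[OF assms(1) xmodule_cell_Cmp[OF assms(2,3)]]
    by (intro xcell_eqI[of X Y f h]) (auto simp: a.f.Y.T.m_assoc)
qed

lemma XMod2_HCmp_Idn_right:
  assumes "xmodule_cell X Y f f' \<alpha>"
  shows "HCmp XMod2 \<alpha> (Idn (vert XMod2) (Idn XMod X)) = \<alpha>"
proof -
  interpret a: xmodule_cell X Y f f' \<alpha> by fact
  show ?thesis
    using assms xmodule_cell_HCmp[OF xmodule_cell_Idn[OF xmodule_mor_Idn[OF a.f.X.crossed_module]] assms]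
    by (intro xcell_eqI[of X Y f f'])
      (auto simp: XMod_Cmp_Idn_right[OF a.f.xmodule_mor_axioms]
        XMod_Cmp_Idn_right[OF a.f'.xmodule_mor_axioms])
qed

lemma XMod2_HCmp_Idn_left:
  assumes "xmodule_cell X Y f f' \<alpha>"
  shows "HCmp XMod2 (Idn (vert XMod2) (Idn XMod Y)) \<alpha> = \<alpha>"
proof -
  interpret a: xmodule_cell X Y f f' \<alpha> by fact
  show ?thesis
    using assms xmodule_cell_HCmp[OF assms xmodule_cell_Idn[OF xmodule_mor_Idn[OF a.f.Y.crossed_module]]]
    by (intro xcell_eqI[of X Y f f'])
      (auto simp: XMod_Cmp_Idn_left[OF a.f.xmodule_mor_axioms]
        XMod_Cmp_Idn_left[OF a.f'.xmodule_mor_axioms])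
qed

lemma XMod2_HCmp_assoc:
  assumes "xmodule_cell X Y f f' \<alpha>" "xmodule_cell Y Z g g' \<beta>" "xmodule_cell Z W h h' \<gamma>"
  shows "HCmp XMod2 \<gamma> (HCmp XMod2 \<beta> \<alpha>) = HCmp XMod2 (HCmp XMod2 \<gamma> \<beta>) \<alpha>"
proof -
  interpret a: xmodule_cell X Y f f' \<alpha> by fact
  interpret b: xmodule_cell Y Z g g' \<beta> by fact
  interpret c: xmodule_cell Z W h h' \<gamma> by fact
  \<comment> \<open>\<open>xcell_eqI\<close> compares cells with literally the same endpoints, so
    the two bracketings of the 1-cells are identified beforehand.\<close>
  have "Cmp XMod h (Cmp XMod g f) = Cmp XMod (Cmp XMod h g) f"
    "Cmp XMod h' (Cmp XMod g' f') = Cmp XMod (Cmp XMod h' g') f'"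
    using XMod_Cmp_assoc[OF a.f.xmodule_mor_axioms b.f.xmodule_mor_axioms c.f.xmodule_mor_axioms]
      XMod_Cmp_assoc[OF a.f'.xmodule_mor_axioms b.f'.xmodule_mor_axioms c.f'.xmodule_mor_axioms]
    by simp_all
  with xmodule_cell_HCmp[OF assms(1) xmodule_cell_HCmp[OF assms(2,3)]]
  have "xmodule_cell X W (Cmp XMod h (Cmp XMod g f)) (Cmp XMod h' (Cmp XMod g' f'))
      (HCmp XMod2 (HCmp XMod2 \<gamma> \<beta>) \<alpha>)"
    by (simp del: XMod2_sel)
  from xmodule_cell_HCmp[OF xmodule_cell_HCmp[OF assms(1,2)] assms(3)] this
  show ?thesis
    by (rule xcell_eqI) (simp add: compose_eq c.f.Y.T.m_assoc)
qed

lemma XMod2_HCmp_Idn: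
  assumes "xmodule_mor X Y f" "xmodule_mor Y Z g"
  shows "HCmp XMod2 (Idn (vert XMod2) g) (Idn (vert XMod2) f) = Idn (vert XMod2) (Cmp XMod g f)"
proof -
  interpret f: xmodule_mor X Y f by fact
  interpret g: xmodule_mor Y Z g by fact
  show ?thesis
    using xmodule_cell_HCmp[OF xmodule_cell_Idn xmodule_cell_Idn, OF assms]
      xmodule_cell_Idn[OF xmodule_mor_Cmp[OF assms]]
    by (intro xcell_eqI[of X Z "Cmp XMod g f" "Cmp XMod g f"]) auto
qed

text \<open>Both composites have the outer factors \<beta>' (f'' x) and g (\<alpha> x); only the two
  inner factors have to be exchanged. With t = \<alpha>' x one has f'' x = \<partial> t times f' x.
  The cocycle law expands \<beta> there, the Peiffer identity makes the twist a conjugation by g t,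
  and \<beta> (\<partial> t) times g t is g' t.\<close>

lemma XMod2_interchange:
  assumes "xmodule_cell X Y f f' \<alpha>" "xmodule_cell X Y f' f'' \<alpha>'"
    and "xmodule_cell Y Z g g' \<beta>" "xmodule_cell Y Z g' g'' \<beta>'"
  shows "HCmp XMod2 (Cmp (vert XMod2) \<beta>' \<beta>) (Cmp (vert XMod2) \<alpha>' \<alpha>)
    = Cmp (vert XMod2) (HCmp XMod2 \<beta>' \<alpha>') (HCmp XMod2 \<beta> \<alpha>)"
proof -
  interpret a: xmodule_cell X Y f f' \<alpha> by fact
  interpret a': xmodule_cell X Y f' f'' \<alpha>' by fact
  interpret b: xmodule_cell Y Z g g' \<beta> by fact
  interpret b': xmodule_cell Y Z g' g'' \<beta>' by fact
  have "cmap \<beta> (mor_base f'' x) \<otimes>\<^bsub>top_group Z\<^esub> mor_top g (cmap \<alpha>' x)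
      = mor_top g' (cmap \<alpha>' x) \<otimes>\<^bsub>top_group Z\<^esub> cmap \<beta> (mor_base f' x)"
    if x: "x \<in> carrier (base_group X)" for x
  proof -
    have "xm_act Z (mor_base g (boundary Y (cmap \<alpha>' x))) (cmap \<beta> (mor_base f' x))
      = mor_top g (cmap \<alpha>' x) \<otimes>\<^bsub>top_group Z\<^esub> cmap \<beta> (mor_base f' x)
        \<otimes>\<^bsub>top_group Z\<^esub> inv\<^bsub>top_group Z\<^esub> mor_top g (cmap \<alpha>' x)"
      using x by (simp flip: b.f.boundary_top)
    then show ?thesis
      using x by (simp add: a'.base_eq b.top_eq b.cocycle b.f.Y.T.m_assoc)
  qed
  \<comment> \<open>The exchange with an arbitrary tail, so that it still rewrites once all products
    are bracketed to the right.\<close>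
  then have "cmap \<beta> (mor_base f'' x) \<otimes>\<^bsub>top_group Z\<^esub> (mor_top g (cmap \<alpha>' x) \<otimes>\<^bsub>top_group Z\<^esub> t)
      = mor_top g' (cmap \<alpha>' x) \<otimes>\<^bsub>top_group Z\<^esub> (cmap \<beta> (mor_base f' x) \<otimes>\<^bsub>top_group Z\<^esub> t)"
    if "x \<in> carrier (base_group X)" "t \<in> carrier (top_group Z)" for x t
    using that by (simp flip: b.f.Y.T.m_assoc)
  with xmodule_cell_HCmp[OF xmodule_cell_Cmp[OF assms(1,2)] xmodule_cell_Cmp[OF assms(3,4)]]
    xmodule_cell_Cmp[OF xmodule_cell_HCmp[OF assms(1,3)] xmodule_cell_HCmp[OF assms(2,4)]]
  show ?thesis
    by (rule_tac xcell_eqI) (auto simp: b.f.Y.T.m_assoc)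
qed

lemma crossed_module_cellD:
  "crossed_module_cell \<alpha> \<Longrightarrow>
    xmodule_cell (xdom (cdom \<alpha>)) (xcod (cdom \<alpha>)) (cdom \<alpha>) (ccod \<alpha>) \<alpha>"
  by (simp add: xmodule_cell_iff)

lemma two_category_XMod2: "two_category (XMod2 :: ('u xmod, 'u xmor, 'u xcell) two_cat)"
proof -
  \<comment> \<open>The axioms of a 2-category only say that endpoints match. \<open>vert\<close>
    and \<open>hor\<close> retype the second cell of a composable pair by the endpoints of the
    first.\<close>
  have vert: "xmodule_cell (xdom (cdom \<alpha>)) (xcod (cdom \<alpha>)) (ccod \<alpha>) (ccod \<beta>) \<beta>"
    if "crossed_module_cell \<alpha>" "crossed_module_cell \<beta>" "ccod \<alpha> = cdom \<beta>" for \<alpha> \<beta> :: "'u xcell"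
    using that by (simp add: xmodule_cell_iff crossed_module_cell_def Let_def)
  have hor: "xmodule_cell (xcod (cdom \<alpha>)) (xcod (cdom \<beta>)) (cdom \<beta>) (ccod \<beta>) \<beta>"
    if "crossed_module_cell \<beta>" "xcod (cdom \<alpha>) = xdom (cdom \<beta>)" for \<alpha> \<beta> :: "'u xcell"
    using that by (simp add: xmodule_cell_iff)
  show ?thesis
  proof (intro two_category.intro)
    show "category (cells1 XMod2 :: ('u xmod, 'u xmor) cat)"
      using category_XMod by simp
    show "category (vert XMod2 :: ('u xmor, 'u xcell) cat)"
    proof
      fix \<alpha> \<beta> \<gamma> :: "'u xcell"
      assume "\<alpha> \<in> Arr (vert XMod2)"
      then have 1: "crossed_module_cell \<alpha>" by simp
      note a = crossed_module_cellD[OF 1]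
      show "Dom (vert XMod2) \<alpha> \<in> Obj (vert XMod2) \<and> Cod (vert XMod2) \<alpha> \<in> Obj (vert XMod2)"
        using 1 by (simp add: crossed_module_cell_def Let_def)
      show "Cmp (vert XMod2) \<alpha> (Idn (vert XMod2) (Dom (vert XMod2) \<alpha>)) = \<alpha>"
        "Cmp (vert XMod2) (Idn (vert XMod2) (Cod (vert XMod2) \<alpha>)) \<alpha> = \<alpha>"
        using XMod2_Cmp_Idn_right[OF a] XMod2_Cmp_Idn_left[OF a] by simp_all
      assume "\<beta> \<in> Arr (vert XMod2)" "Cod (vert XMod2) \<alpha> = Dom (vert XMod2) \<beta>"
      then have 2: "crossed_module_cell \<beta>" "ccod \<alpha> = cdom \<beta>" by simp_all
      note b = vert[OF 1 2]
      show "Cmp (vert XMod2) \<beta> \<alpha> \<in> Arr (vert XMod2) \<and>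
          Dom (vert XMod2) (Cmp (vert XMod2) \<beta> \<alpha>) = Dom (vert XMod2) \<alpha> \<and>
          Cod (vert XMod2) (Cmp (vert XMod2) \<beta> \<alpha>) = Cod (vert XMod2) \<beta>"
        using xmodule_cell_Cmp[OF a b] by (simp add: xmodule_cell_iff)
      assume "\<gamma> \<in> Arr (vert XMod2)" "Cod (vert XMod2) \<beta> = Dom (vert XMod2) \<gamma>"
      then have 3: "crossed_module_cell \<gamma>" "ccod \<beta> = cdom \<gamma>" by simp_all
      have "xdom (cdom \<beta>) = xdom (cdom \<alpha>)" "xcod (cdom \<beta>) = xcod (cdom \<alpha>)"
        using b 2 by (simp_all add: xmodule_cell_iff)
      with vert[OF 2(1) 3] have c: "xmodule_cell (xdom (cdom \<alpha>)) (xcod (cdom \<alpha>)) (ccod \<beta>) (ccod \<gamma>) \<gamma>"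
        by simp
      show "Cmp (vert XMod2) \<gamma> (Cmp (vert XMod2) \<beta> \<alpha>) = Cmp (vert XMod2) (Cmp (vert XMod2) \<gamma> \<beta>) \<alpha>"
        using XMod2_Cmp_assoc[OF a b c] .
    next
      fix f :: "'u xmor"
      assume "f \<in> Obj (vert XMod2)"
      then have "xmodule_mor (xdom f) (xcod f) f" by (simp add: xmodule_mor_iff)
      then show "Idn (vert XMod2) f \<in> Arr (vert XMod2) \<and> Dom (vert XMod2) (Idn (vert XMod2) f) = f \<and>
          Cod (vert XMod2) (Idn (vert XMod2) f) = f"
        using xmodule_cell_Idn by (auto simp: xmodule_cell_iff)
    qed
  next
    fix \<alpha> \<beta> \<gamma> :: "'u xcell"
    assume "\<alpha> \<in> Arr (vert XMod2)"
    then have 1: "crossed_module_cell \<alpha>" by simp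
    note a = crossed_module_cellD[OF 1]
    show "Dom (cells1 XMod2) (Dom (vert XMod2) \<alpha>) = Dom (cells1 XMod2) (Cod (vert XMod2) \<alpha>) \<and>
        Cod (cells1 XMod2) (Dom (vert XMod2) \<alpha>) = Cod (cells1 XMod2) (Cod (vert XMod2) \<alpha>)"
      using 1 by (simp add: crossed_module_cell_def Let_def)
    show "HCmp XMod2 \<alpha> (Idn (vert XMod2) (Idn (cells1 XMod2) (dom0 XMod2 \<alpha>))) = \<alpha>"
      "HCmp XMod2 (Idn (vert XMod2) (Idn (cells1 XMod2) (cod0 XMod2 \<alpha>))) \<alpha> = \<alpha>"
      using XMod2_HCmp_Idn_right[OF a] XMod2_HCmp_Idn_left[OF a] by simp_all
    assume "\<beta> \<in> Arr (vert XMod2)" "cod0 XMod2 \<alpha> = dom0 XMod2 \<beta>"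
    then have 2: "crossed_module_cell \<beta>" "xcod (cdom \<alpha>) = xdom (cdom \<beta>)" by simp_all
    note b = hor[OF 2]
    show "HCmp XMod2 \<beta> \<alpha> \<in> Arr (vert XMod2) \<and>
        Dom (vert XMod2) (HCmp XMod2 \<beta> \<alpha>) = Cmp (cells1 XMod2) (Dom (vert XMod2) \<beta>) (Dom (vert XMod2) \<alpha>) \<and>
        Cod (vert XMod2) (HCmp XMod2 \<beta> \<alpha>) = Cmp (cells1 XMod2) (Cod (vert XMod2) \<beta>) (Cod (vert XMod2) \<alpha>)"
      using xmodule_cell_HCmp[OF a b] by (simp add: xmodule_cell_iff)
    assume "\<gamma> \<in> Arr (vert XMod2)" "cod0 XMod2 \<beta> = dom0 XMod2 \<gamma>"
    then have 3: "crossed_module_cell \<gamma>" "xcod (cdom \<beta>) = xdom (cdom \<gamma>)" by simp_all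
    show "HCmp XMod2 \<gamma> (HCmp XMod2 \<beta> \<alpha>) = HCmp XMod2 (HCmp XMod2 \<gamma> \<beta>) \<alpha>"
      using XMod2_HCmp_assoc[OF a b hor[OF 3]] .
  next
    fix f g :: "'u xmor"
    assume "f \<in> Arr (cells1 XMod2)" "g \<in> Arr (cells1 XMod2)"
      "Cod (cells1 XMod2) f = Dom (cells1 XMod2) g"
    then have "xmodule_mor (xdom f) (xdom g) f" "xmodule_mor (xdom g) (xcod g) g"
      by (auto simp: xmodule_mor_iff)
    then show "HCmp XMod2 (Idn (vert XMod2) g) (Idn (vert XMod2) f)
        = Idn (vert XMod2) (Cmp (cells1 XMod2) g f)"
      using XMod2_HCmp_Idn by simp
  next
    fix \<alpha> \<alpha>' \<beta> \<beta>' :: "'u xcell"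
    assume "\<alpha> \<in> Arr (vert XMod2)" "\<alpha>' \<in> Arr (vert XMod2)" "\<beta> \<in> Arr (vert XMod2)"
      "\<beta>' \<in> Arr (vert XMod2)" "Cod (vert XMod2) \<alpha> = Dom (vert XMod2) \<alpha>'"
      "Cod (vert XMod2) \<beta> = Dom (vert XMod2) \<beta>'" "cod0 XMod2 \<alpha> = dom0 XMod2 \<beta>"
    then have *: "crossed_module_cell \<alpha>" "crossed_module_cell \<alpha>'" "crossed_module_cell \<beta>"
      "crossed_module_cell \<beta>'" "ccod \<alpha> = cdom \<alpha>'" "ccod \<beta> = cdom \<beta>'" "xcod (cdom \<alpha>) = xdom (cdom \<beta>)"
      by simp_all
    show "HCmp XMod2 (Cmp (vert XMod2) \<beta>' \<beta>) (Cmp (vert XMod2) \<alpha>' \<alpha>)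
        = Cmp (vert XMod2) (HCmp XMod2 \<beta>' \<alpha>') (HCmp XMod2 \<beta> \<alpha>)"
      using XMod2_interchange[OF crossed_module_cellD[OF *(1)] vert[OF *(1,2,5)]
          hor[OF *(3,7)] vert[OF *(3,4,6), folded *(7)]] .
  qed simp
qed

section \<open>Actions in terms of elements\<close>

lemma two_cat_of_sel [simp]:
  "Obj (cells1 (two_cat_of X)) = {()}" "Arr (cells1 (two_cat_of X)) = carrier (base_group X)"
  "Idn (cells1 (two_cat_of X)) z = \<one>\<^bsub>base_group X\<^esub>"
  "Cmp (cells1 (two_cat_of X)) p q = p \<otimes>\<^bsub>base_group X\<^esub> q"
  "Obj (vert (two_cat_of X)) = carrier (base_group X)"
  "Arr (vert (two_cat_of X)) = carrier (top_group X) \<times> carrier (base_group X)"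
  "Dom (vert (two_cat_of X)) = snd"
  "Cod (vert (two_cat_of X)) (m, p) = boundary X m \<otimes>\<^bsub>base_group X\<^esub> p"
  "Idn (vert (two_cat_of X)) p = (\<one>\<^bsub>top_group X\<^esub>, p)"
  "Cmp (vert (two_cat_of X)) (m', p') (m, p) = (m' \<otimes>\<^bsub>top_group X\<^esub> m, p)"
  "HCmp (two_cat_of X) (m', p') (m, p)
    = (m' \<otimes>\<^bsub>top_group X\<^esub> xm_act X p' m, p' \<otimes>\<^bsub>base_group X\<^esub> p)"
  by (auto simp: two_cat_of_def Let_def)

text \<open>Both axioms of a crossed module enter: the formula for \<mu> on \<open>xm_act\<close>
  gives the target of a horizontal composite, the Peiffer identity gives interchange.\<close>

lemma two_category_two_cat_of:
  assumes "crossed_module X"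
  shows "two_category (two_cat_of X)"
proof -
  interpret xmodule X by unfold_locales fact
  have "category (cells1 (two_cat_of X))"
    by unfold_locales (auto simp: G.m_assoc)
  moreover have "category (vert (two_cat_of X))"
    by unfold_locales (auto simp: T.m_assoc G.m_assoc)
  ultimately show ?thesis
    by (intro two_category.intro) (auto simp: T.m_assoc G.m_assoc act.comp)
qed

text \<open>\<open>B\<close> acts on \<open>E\<close>. \<open>boundary_top\<close> and
  \<open>top_act\<close> make each pair (\<open>\<theta> p\<close>, \<open>\<sigma> p\<close>) an
  endomorphism of \<open>E\<close>. \<open>boundary_phi\<close>, \<open>phi_boundary\<close> and
  \<open>phi_mult_right\<close> say that \<phi>(m, -) is a 2-cell from the identity to the pair at
  \<mu> m. \<open>phi_mult_left\<close> encodes vertical composition, and \<open>top_phi\<close>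
  encodes whiskering by p.\<close>

locale xmodule_action = B: xmodule B + E: xmodule E +
    top: automorphism_action "base_group B" "top_group E" \<theta> +
    base: automorphism_action "base_group B" "base_group E" \<sigma>
  for B E :: "'u xmod" and \<theta> \<sigma> :: "'u \<Rightarrow> 'u \<Rightarrow> 'u" +
  fixes \<phi> :: "'u \<times> 'u \<Rightarrow> 'u"
  assumes phi: "\<phi> \<in> carrier (top_group B) \<times> carrier (base_group E) \<rightarrow>\<^sub>E carrier (top_group E)"
    and boundary_top: "\<lbrakk>p \<in> carrier (base_group B); t \<in> carrier (top_group E)\<rbrakk> \<Longrightarrow>
      boundary E (\<theta> p t) = \<sigma> p (boundary E t)"
    and top_act: "\<lbrakk>p \<in> carrier (base_group B); x \<in> carrier (base_group E); t \<in> carrier (top_group E)\<rbrakk> \<Longrightarrow>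
      \<theta> p (xm_act E x t) = xm_act E (\<sigma> p x) (\<theta> p t)"
    and boundary_phi: "\<lbrakk>m \<in> carrier (top_group B); x \<in> carrier (base_group E)\<rbrakk> \<Longrightarrow>
      boundary E (\<phi> (m, x)) = \<sigma> (boundary B m) x \<otimes>\<^bsub>base_group E\<^esub> inv\<^bsub>base_group E\<^esub> x"
    and phi_boundary: "\<lbrakk>m \<in> carrier (top_group B); t \<in> carrier (top_group E)\<rbrakk> \<Longrightarrow>
      \<phi> (m, boundary E t) = \<theta> (boundary B m) t \<otimes>\<^bsub>top_group E\<^esub> inv\<^bsub>top_group E\<^esub> t"
    and phi_mult_left: "\<lbrakk>m \<in> carrier (top_group B); n \<in> carrier (top_group B); x \<in> carrier (base_group E)\<rbrakk> \<Longrightarrow>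
      \<phi> (m \<otimes>\<^bsub>top_group B\<^esub> n, x) = \<theta> (boundary B m) (\<phi> (n, x)) \<otimes>\<^bsub>top_group E\<^esub> \<phi> (m, x)"
    and phi_mult_right: "\<lbrakk>m \<in> carrier (top_group B); x \<in> carrier (base_group E); y \<in> carrier (base_group E)\<rbrakk> \<Longrightarrow>
      \<phi> (m, x \<otimes>\<^bsub>base_group E\<^esub> y) = \<phi> (m, x) \<otimes>\<^bsub>top_group E\<^esub> xm_act E x (\<phi> (m, y))"
    and top_phi: "\<lbrakk>p \<in> carrier (base_group B); m \<in> carrier (top_group B); x \<in> carrier (base_group E)\<rbrakk> \<Longrightarrow>
      \<theta> p (\<phi> (m, x)) = \<phi> (xm_act B p m, \<sigma> p x)"
begin

lemma phi_closed [simp]: "\<lbrakk>m \<in> carrier (top_group B); x \<in> carrier (base_group E)\<rbrakk> \<Longrightarrow>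
    \<phi> (m, x) \<in> carrier (top_group E)"
  using phi by auto

text \<open>The element \<phi>(1, x) is idempotent, by \<open>phi_mult_left\<close> at m = n =
  1.\<close>

lemma phi_one_left [simp]:
  assumes "x \<in> carrier (base_group E)"
  shows "\<phi> (\<one>\<^bsub>top_group B\<^esub>, x) = \<one>\<^bsub>top_group E\<^esub>"
  using phi_mult_left[of "\<one>\<^bsub>top_group B\<^esub>" "\<one>\<^bsub>top_group B\<^esub>" x] assms by simp

text \<open>The form dictated by vertical composition, (m n, 1) being (m, \<mu> n) after (n, 1).
  Writing \<sigma>(\<mu> n) x as \<partial>(\<phi>(n, x)) x and expanding by
  \<open>phi_mult_right\<close>, the first factor is given by \<open>phi_boundary\<close> and the
  second is a conjugate by the Peiffer identity.\<close>

lemma phi_mult_left':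
  assumes "m \<in> carrier (top_group B)" "n \<in> carrier (top_group B)" "x \<in> carrier (base_group E)"
  shows "\<phi> (m \<otimes>\<^bsub>top_group B\<^esub> n, x) = \<phi> (m, \<sigma> (boundary B n) x) \<otimes>\<^bsub>top_group E\<^esub> \<phi> (n, x)"
proof -
  have "\<sigma> (boundary B n) x = boundary E (\<phi> (n, x)) \<otimes>\<^bsub>base_group E\<^esub> x"
    using assms by (simp add: boundary_phi E.G.m_assoc)
  with assms show ?thesis
    by (simp add: phi_mult_right phi_boundary phi_mult_left E.T.m_assoc)
qed

end

section \<open>From elementwise data to a 2-functor\<close>

definition make_action ::
    "'u xmod \<Rightarrow> 'u xmod \<Rightarrow> ('u \<Rightarrow> 'u \<Rightarrow> 'u) \<Rightarrow> ('u \<Rightarrow> 'u \<Rightarrow> 'u) \<Rightarrow> ('u \<times> 'u \<Rightarrow> 'u) \<Rightarrow> 'u xaction" where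
  "make_action B E \<theta> \<sigma> \<phi> = (let
      mor = (\<lambda>p. \<lparr>xdom = E, xcod = E, mor_top = \<theta> p, mor_base = \<sigma> p\<rparr>)
    in \<lparr>act_functor = \<lparr>
        on0 = (\<lambda>_. E),
        on1 = (\<lambda>p\<in>carrier (base_group B). mor p),
        on2 = (\<lambda>(m, p)\<in>carrier (top_group B) \<times> carrier (base_group B).
          \<lparr>cdom = mor p, ccod = mor (boundary B m \<otimes>\<^bsub>base_group B\<^esub> p),
           cmap = (\<lambda>x\<in>carrier (base_group E). \<phi> (m, \<sigma> p x))\<rparr>)\<rparr>,
      actor = B\<rparr>)"

lemma make_action_sel [simp]:
  "actor (make_action B E \<theta> \<sigma> \<phi>) = B"
  "on0 (act_functor (make_action B E \<theta> \<sigma> \<phi>)) z = E"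
  "p \<in> carrier (base_group B) \<Longrightarrow> on1 (act_functor (make_action B E \<theta> \<sigma> \<phi>)) p
    = \<lparr>xdom = E, xcod = E, mor_top = \<theta> p, mor_base = \<sigma> p\<rparr>"
  "\<lbrakk>m \<in> carrier (top_group B); p \<in> carrier (base_group B)\<rbrakk> \<Longrightarrow>
    on2 (act_functor (make_action B E \<theta> \<sigma> \<phi>)) (m, p) =
      \<lparr>cdom = \<lparr>xdom = E, xcod = E, mor_top = \<theta> p, mor_base = \<sigma> p\<rparr>,
       ccod = \<lparr>xdom = E, xcod = E, mor_top = \<theta> (boundary B m \<otimes>\<^bsub>base_group B\<^esub> p),
         mor_base = \<sigma> (boundary B m \<otimes>\<^bsub>base_group B\<^esub> p)\<rparr>,
       cmap = (\<lambda>x\<in>carrier (base_group E). \<phi> (m, \<sigma> p x))\<rparr>"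
  by (simp_all add: make_action_def Let_def)

lemma (in xmodule_action) mor:
  assumes "p \<in> carrier (base_group B)"
  shows "xmodule_mor E E \<lparr>xdom = E, xcod = E, mor_top = \<theta> p, mor_base = \<sigma> p\<rparr>"
  using assms E.crossed_module
  by (intro xmodule_morI) (auto simp: boundary_top top_act top.ext2 base.ext2)

text \<open>This is the 2-cell \<phi>(m, -) precomposed with (\<open>\<theta> p\<close>,
  \<open>\<sigma> p\<close>). In the equation for the top groups, \<open>boundary_top\<close> is
  read from right to left: \<open>\<sigma> p\<close> of a boundary becomes a boundary, and
  \<open>phi_boundary\<close> applies.\<close>

lemma (in xmodule_action) cell:
  assumes "m \<in> carrier (top_group B)" "p \<in> carrier (base_group B)"
  shows "xmodule_cell E E \<lparr>xdom = E, xcod = E, mor_top = \<theta> p, mor_base = \<sigma> p\<rparr>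
    \<lparr>xdom = E, xcod = E, mor_top = \<theta> (boundary B m \<otimes>\<^bsub>base_group B\<^esub> p),
      mor_base = \<sigma> (boundary B m \<otimes>\<^bsub>base_group B\<^esub> p)\<rparr>
    (on2 (act_functor (make_action B E \<theta> \<sigma> \<phi>)) (m, p))"
  using assms mor
  by (intro xmodule_cellI)
    (auto simp: boundary_phi phi_boundary phi_mult_right top.comp base.comp E.G.m_assoc E.T.m_assoc
      simp flip: boundary_top)

lemma (in xmodule_action) crossed_module_action_make_action:
  "crossed_module_action (make_action B E \<theta> \<sigma> \<phi>)"
proof -
  let ?F = "act_functor (make_action B E \<theta> \<sigma> \<phi>)"
  interpret K: two_category "two_cat_of B"
    by (rule two_category_two_cat_of[OF B.crossed_module])
  interpret L: two_category XMod2
    by (rule two_category_XMod2)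
  have one: "\<lparr>xdom = E, xcod = E, mor_top = \<theta> \<one>\<^bsub>base_group B\<^esub>, mor_base = \<sigma> \<one>\<^bsub>base_group B\<^esub>\<rparr> = Idn XMod E"
    using mor xmodule_mor_Idn[OF E.crossed_module] by (intro xmor_eqI[of E E]) auto
  have mult: "\<lparr>xdom = E, xcod = E, mor_top = \<theta> (p \<otimes>\<^bsub>base_group B\<^esub> q), mor_base = \<sigma> (p \<otimes>\<^bsub>base_group B\<^esub> q)\<rparr>
      = Cmp XMod \<lparr>xdom = E, xcod = E, mor_top = \<theta> p, mor_base = \<sigma> p\<rparr>
        \<lparr>xdom = E, xcod = E, mor_top = \<theta> q, mor_base = \<sigma> q\<rparr>"
    if "p \<in> carrier (base_group B)" "q \<in> carrier (base_group B)" for p q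
    using that mor xmodule_mor_Cmp[OF mor mor, of q p]
    by (intro xmor_eqI[of E E]) (auto simp: compose_eq top.comp base.comp)
  have "strict_two_functor (two_cat_of B) XMod2 ?F"
  proof (intro strict_two_functor.intro strict_two_functor_axioms.intro
      K.two_category_axioms L.two_category_axioms)
    show "on0 ?F \<in> extensional (Obj (cells1 (two_cat_of B)))"
      "on1 ?F \<in> extensional (Arr (cells1 (two_cat_of B)))"
      "on2 ?F \<in> extensional (Arr (vert (two_cat_of B)))"
      by (auto simp: make_action_def Let_def extensional_def)
    show "cat_functor (cells1 (two_cat_of B)) (cells1 XMod2) \<lparr>on_obj = on0 ?F, on_arr = on1 ?F\<rparr>"
      using K.cells1 L.cells1 E.crossed_module mor
      by (intro cat_functor.intro cat_functor_axioms.intro) (auto simp: one mult xmodule_mor_iff)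
    \<comment> \<open>Preservation of vertical composition is \<open>phi_mult_left'\<close> at the
      argument \<open>\<sigma> p x\<close>.\<close>
    show "cat_functor (vert (two_cat_of B)) (vert XMod2) \<lparr>on_obj = on1 ?F, on_arr = on2 ?F\<rparr>"
      using K.vert L.vert mor cell
      by (intro cat_functor.intro cat_functor_axioms.intro)
        (auto simp: XMod2_def phi_mult_left' base.comp B.G.m_assoc xmodule_mor_iff xmodule_cell_iff
          simp del: XMod2_sel cong: restrict_cong)
    fix \<alpha> \<beta>
    assume "\<alpha> \<in> Arr (vert (two_cat_of B))" "\<beta> \<in> Arr (vert (two_cat_of B))"
    \<comment> \<open>\<open>phi_mult_left'\<close> splits the value at the horizontal composite
      into two factors; \<open>top_phi\<close> turns the second one into \<open>\<theta> p'\<close>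
      of \<phi>(m, \<open>\<sigma> p x\<close>), as horizontal composition in \<open>XMod2\<close>
      requires.\<close>
    then show "on2 ?F (HCmp (two_cat_of B) \<beta> \<alpha>) = HCmp XMod2 (on2 ?F \<beta>) (on2 ?F \<alpha>)"
      by (auto simp: XMod2_def phi_mult_left' base.comp top_phi B.G.m_assoc
          simp flip: mult simp del: XMod2_sel cong: restrict_cong)
  qed
  then show ?thesis
    using B.crossed_module by (simp add: crossed_module_action_def)
qed

section \<open>From a 2-functor back to elementwise data\<close>

definition action_top :: "'u xaction \<Rightarrow> 'u \<Rightarrow> 'u \<Rightarrow> 'u" where
  "action_top A = (\<lambda>p\<in>carrier (base_group (actor A)). mor_top (on1 (act_functor A) p))"

definition action_base :: "'u xaction \<Rightarrow> 'u \<Rightarrow> 'u \<Rightarrow> 'u" where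
  "action_base A = (\<lambda>p\<in>carrier (base_group (actor A)). mor_base (on1 (act_functor A) p))"

definition action_phi :: "'u xaction \<Rightarrow> 'u \<times> 'u \<Rightarrow> 'u" where
  "action_phi A = (\<lambda>(m, x)\<in>carrier (top_group (actor A)) \<times> carrier (base_group (on0 (act_functor A) ())).
    cmap (on2 (act_functor A) (m, \<one>\<^bsub>base_group (actor A)\<^esub>)) x)"

text \<open>The cells (m, 1) start at the identity of \<open>E\<close>. Their cell axioms, their
  vertical composites and their whiskerings by p on either side give the laws that involve \<phi>.
  The second claim is an equality of records, without which the correspondence on objects would not
  be a bijection.\<close>

lemma crossed_module_actionD:
  fixes A :: "'u xaction"
  assumes "crossed_module_action A"
  defines "B \<equiv> actor A" and "E \<equiv> on0 (act_functor A) ()"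
  shows "xmodule_action B E (action_top A) (action_base A) (action_phi A)"
    and "A = make_action B E (action_top A) (action_base A) (action_phi A)"
proof -
  define F where "F = act_functor A"
  define \<theta> \<sigma> \<phi> where "\<theta> = action_top A" and "\<sigma> = action_base A" and "\<phi> = action_phi A"
  interpret strict_two_functor "two_cat_of B" XMod2 F
    using assms by (simp add: crossed_module_action_def F_def)
  interpret F1: cat_functor "cells1 (two_cat_of B)" XMod "\<lparr>on_obj = on0 F, on_arr = on1 F\<rparr>"
    using functor1 by simp
  interpret F2: cat_functor "vert (two_cat_of B)" "vert XMod2" "\<lparr>on_obj = on1 F, on_arr = on2 F\<rparr>"
    using functor2 by simp
  interpret B: xmodule B
    using assms by unfold_locales (simp add: crossed_module_action_def)
  interpret E: xmodule E
    using F1.on_obj[of "()"] by unfold_locales (simp add: E_def F_def)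
  have mor: "xmodule_mor E E (on1 F p)" if "p \<in> carrier (base_group B)" for p
    using F1.on_arr[of p] that by (simp add: xmodule_mor_iff E_def F_def)
  have \<theta>: "\<theta> p = mor_top (on1 F p)" and \<sigma>: "\<sigma> p = mor_base (on1 F p)"
    if "p \<in> carrier (base_group B)" for p
    using that by (simp_all add: \<theta>_def \<sigma>_def action_top_def action_base_def B_def F_def)
  have \<phi>: "\<phi> (m, x) = cmap (on2 F (m, \<one>\<^bsub>base_group B\<^esub>)) x"
    if "m \<in> carrier (top_group B)" "x \<in> carrier (base_group E)" for m x
    using that by (simp add: \<phi>_def action_phi_def B_def F_def E_def)
  have cell: "xmodule_cell E E (on1 F p) (on1 F (boundary B m \<otimes>\<^bsub>base_group B\<^esub> p)) (on2 F (m, p))"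
    if "m \<in> carrier (top_group B)" "p \<in> carrier (base_group B)" for m p
    using F2.on_arr[of "(m, p)"] mor[OF that(2)] that by (simp add: xmodule_cell_iff xmodule_mor_iff)
  have one: "on1 F \<one>\<^bsub>base_group B\<^esub> = Idn XMod E"
    using F1.on_idn[of "()"] by (simp add: E_def F_def)
  have mult: "on1 F (p \<otimes>\<^bsub>base_group B\<^esub> q) = Cmp XMod (on1 F p) (on1 F q)"
    if "p \<in> carrier (base_group B)" "q \<in> carrier (base_group B)" for p q
    using F1.on_cmp[of q p] that by simp
  have top: "\<theta> \<in> group_acts (base_group B) (top_group E)"
    unfolding group_acts_iff[OF B.G.is_group E.T.is_group]
  proof (intro conjI ballI)
    show "\<theta> \<in> extensional (carrier (base_group B))"
      by (simp add: \<theta>_def action_top_def B_def)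
    fix p assume p: "p \<in> carrier (base_group B)"
    then interpret f: xmodule_mor E E "on1 F p" by (rule mor)
    show "\<theta> p \<in> extensional (carrier (top_group E))" "\<theta> p \<in> hom (top_group E) (top_group E)"
      using p f.top_ext f.top.homh by (simp_all add: \<theta>)
    fix q t assume "q \<in> carrier (base_group B)" "t \<in> carrier (top_group E)"
    with p show "\<theta> (p \<otimes>\<^bsub>base_group B\<^esub> q) t = \<theta> p (\<theta> q t)"
      using mor by (auto simp: \<theta> mult xmodule_mor_iff compose_eq)
  next
    fix t assume "t \<in> carrier (top_group E)"
    then show "\<theta> \<one>\<^bsub>base_group B\<^esub> t = t" by (simp add: \<theta> one)
  qed
  have base: "\<sigma> \<in> group_acts (base_group B) (base_group E)"
    unfolding group_acts_iff[OF B.G.is_group E.G.is_group]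
  proof (intro conjI ballI)
    show "\<sigma> \<in> extensional (carrier (base_group B))"
      by (simp add: \<sigma>_def action_base_def B_def)
    fix p assume p: "p \<in> carrier (base_group B)"
    then interpret f: xmodule_mor E E "on1 F p" by (rule mor)
    show "\<sigma> p \<in> extensional (carrier (base_group E))" "\<sigma> p \<in> hom (base_group E) (base_group E)"
      using p f.base_ext f.base.homh by (simp_all add: \<sigma>)
    fix q x assume "q \<in> carrier (base_group B)" "x \<in> carrier (base_group E)"
    with p show "\<sigma> (p \<otimes>\<^bsub>base_group B\<^esub> q) x = \<sigma> p (\<sigma> q x)"
      using mor by (auto simp: \<sigma> mult xmodule_mor_iff compose_eq)
  next
    fix x assume "x \<in> carrier (base_group E)"
    then show "\<sigma> \<one>\<^bsub>base_group B\<^esub> x = x" by (simp add: \<sigma> one)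
  qed
  interpret top: automorphism_action "base_group B" "top_group E" \<theta> by unfold_locales fact
  interpret base: automorphism_action "base_group B" "base_group E" \<sigma> by unfold_locales fact
  have Idn: "on2 F (\<one>\<^bsub>top_group B\<^esub>, p) = Idn (vert XMod2) (on1 F p)"
    if "p \<in> carrier (base_group B)" for p
    using F2.on_idn[of p] that by simp
  \<comment> \<open>Because the source of the cell at (m, 1) is the identity, its defining equations
    are (4) and (8), the former solved for \<sigma>; the fact \<open>phi_boundary\<close> obtains
    (6) in the same way.\<close>
  have phi_closed: "\<phi> (m, x) \<in> carrier (top_group E)"
    and boundary_phi: "\<sigma> (boundary B m) x = boundary E (\<phi> (m, x)) \<otimes>\<^bsub>base_group E\<^esub> x"
    and phi_mult_right: "y \<in> carrier (base_group E) \<Longrightarrow>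
      \<phi> (m, x \<otimes>\<^bsub>base_group E\<^esub> y) = \<phi> (m, x) \<otimes>\<^bsub>top_group E\<^esub> xm_act E x (\<phi> (m, y))"
    if m: "m \<in> carrier (top_group B)" and x: "x \<in> carrier (base_group E)" for m x y
  proof -
    interpret c: xmodule_cell E E "on1 F \<one>\<^bsub>base_group B\<^esub>" "on1 F (boundary B m)" "on2 F (m, \<one>\<^bsub>base_group B\<^esub>)"
      using cell[OF m B.G.one_closed] m by simp
    show "\<phi> (m, x) \<in> carrier (top_group E)"
      "\<sigma> (boundary B m) x = boundary E (\<phi> (m, x)) \<otimes>\<^bsub>base_group E\<^esub> x"
      using m x c.base_eq[of x] by (simp_all add: \<phi> \<sigma> one)
    show "\<phi> (m, x \<otimes>\<^bsub>base_group E\<^esub> y) = \<phi> (m, x) \<otimes>\<^bsub>top_group E\<^esub> xm_act E x (\<phi> (m, y))"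
      if "y \<in> carrier (base_group E)"
      using m x that c.cocycle[of x y] by (simp add: \<phi> one)
  qed
  have phi_boundary: "\<theta> (boundary B m) t = \<phi> (m, boundary E t) \<otimes>\<^bsub>top_group E\<^esub> t"
    if m: "m \<in> carrier (top_group B)" and t: "t \<in> carrier (top_group E)" for m t
  proof -
    interpret c: xmodule_cell E E "on1 F \<one>\<^bsub>base_group B\<^esub>" "on1 F (boundary B m)" "on2 F (m, \<one>\<^bsub>base_group B\<^esub>)"
      using cell[OF m B.G.one_closed] m by simp
    show ?thesis
      using m t c.top_eq[of t] by (simp add: \<phi> \<theta> one)
  qed
  have cmap: "cmap (on2 F (m, p)) x = \<phi> (m, \<sigma> p x)"
    if m: "m \<in> carrier (top_group B)" and p: "p \<in> carrier (base_group B)"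
      and x: "x \<in> carrier (base_group E)" for m p x
  proof -
    interpret f: xmodule_mor E E "on1 F p" using p by (rule mor)
    interpret c: xmodule_cell E E "on1 F \<one>\<^bsub>base_group B\<^esub>" "on1 F (boundary B m)" "on2 F (m, \<one>\<^bsub>base_group B\<^esub>)"
      using cell[OF m B.G.one_closed] m by simp
    have "on2 F (m, p) = HCmp XMod2 (on2 F (m, \<one>\<^bsub>base_group B\<^esub>)) (Idn (vert XMod2) (on1 F p))"
      using on_hcmp[of "(\<one>\<^bsub>top_group B\<^esub>, p)" "(m, \<one>\<^bsub>base_group B\<^esub>)"] m p
      by (simp add: Idn dom0_def cod0_def)
    then show ?thesis
      using m p x by (simp add: \<phi> \<sigma>)
  qed
  have top_phi: "\<theta> p (\<phi> (m, x)) = \<phi> (xm_act B p m, \<sigma> p x)"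
    if p: "p \<in> carrier (base_group B)" and m: "m \<in> carrier (top_group B)"
      and x: "x \<in> carrier (base_group E)" for p m x
  proof -
    interpret f: xmodule_mor E E "on1 F p" using p by (rule mor)
    interpret c: xmodule_cell E E "on1 F \<one>\<^bsub>base_group B\<^esub>" "on1 F (boundary B m)" "on2 F (m, \<one>\<^bsub>base_group B\<^esub>)"
      using cell[OF m B.G.one_closed] m by simp
    \<comment> \<open>Whiskering on the other side: (1, p) * (m, 1) is (\<open>xm_act B p m\<close>,
      p). Evaluating both expressions for its image, one of them by \<open>cmap\<close>, yields
      (9).\<close>
    have "on2 F (xm_act B p m, p) = HCmp XMod2 (Idn (vert XMod2) (on1 F p)) (on2 F (m, \<one>\<^bsub>base_group B\<^esub>))"
      using on_hcmp[of "(m, \<one>\<^bsub>base_group B\<^esub>)" "(\<one>\<^bsub>top_group B\<^esub>, p)"] m p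
      by (simp add: Idn dom0_def cod0_def)
    then have "cmap (on2 F (xm_act B p m, p)) x = \<theta> p (\<phi> (m, x))"
      using m p x by (simp add: \<phi> \<theta>)
    then show ?thesis
      using m p x by (simp add: cmap)
  qed
  have phi_mult_left: "\<phi> (m \<otimes>\<^bsub>top_group B\<^esub> n, x) = \<theta> (boundary B m) (\<phi> (n, x)) \<otimes>\<^bsub>top_group E\<^esub> \<phi> (m, x)"
    if m: "m \<in> carrier (top_group B)" and n: "n \<in> carrier (top_group B)"
      and x: "x \<in> carrier (base_group E)" for m n x
  proof -
    \<comment> \<open>The pair (m, \<mu> n) is the cell that starts where (n, 1) ends. The resulting
      product is then brought into the form (7) as in \<open>phi_mult_left'\<close>.\<close>
    have "on2 F (m \<otimes>\<^bsub>top_group B\<^esub> n, \<one>\<^bsub>base_group B\<^esub>)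
        = Cmp (vert XMod2) (on2 F (m, boundary B n)) (on2 F (n, \<one>\<^bsub>base_group B\<^esub>))"
      using F2.on_cmp[of "(n, \<one>\<^bsub>base_group B\<^esub>)" "(m, boundary B n)"] m n by simp
    then have "\<phi> (m \<otimes>\<^bsub>top_group B\<^esub> n, x)
        = \<phi> (m, \<sigma> (boundary B n) x) \<otimes>\<^bsub>top_group E\<^esub> \<phi> (n, x)"
      using m n x cell[OF n B.G.one_closed] by (simp add: \<phi>[of "m \<otimes>\<^bsub>top_group B\<^esub> n"] cmap one xmodule_cell_iff)
    then show ?thesis
      using m n x phi_closed
      by (simp add: boundary_phi phi_mult_right phi_boundary E.T.m_assoc)
  qed
  have phi: "\<phi> \<in> carrier (top_group B) \<times> carrier (base_group E) \<rightarrow>\<^sub>E carrier (top_group E)"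
    using phi_closed by (auto simp: PiE_def \<phi>_def action_phi_def B_def E_def)
  show 1: "xmodule_action B E (action_top A) (action_base A) (action_phi A)"
    unfolding \<theta>_def[symmetric] \<sigma>_def[symmetric] \<phi>_def[symmetric]
  proof (intro xmodule_action.intro xmodule_action_axioms.intro)
    show "boundary E (\<phi> (m, x)) = \<sigma> (boundary B m) x \<otimes>\<^bsub>base_group E\<^esub> inv\<^bsub>base_group E\<^esub> x"
      if "m \<in> carrier (top_group B)" "x \<in> carrier (base_group E)" for m x
      using that boundary_phi[OF that] phi_closed[OF that] by (simp add: E.G.m_assoc)
    show "\<phi> (m, boundary E t) = \<theta> (boundary B m) t \<otimes>\<^bsub>top_group E\<^esub> inv\<^bsub>top_group E\<^esub> t"
      if "m \<in> carrier (top_group B)" "t \<in> carrier (top_group E)" for m t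
      using that phi_boundary[OF that] phi_closed[of m "boundary E t"] by (simp add: E.T.m_assoc)
    fix p t assume pt: "p \<in> carrier (base_group B)" "t \<in> carrier (top_group E)"
    then interpret f: xmodule_mor E E "on1 F p" by (intro mor)
    show "boundary E (\<theta> p t) = \<sigma> p (boundary E t)"
      using pt by (simp add: \<theta> \<sigma> f.boundary_top)
    fix x assume "x \<in> carrier (base_group E)"
    with pt show "\<theta> p (xm_act E x t) = xm_act E (\<sigma> p x) (\<theta> p t)"
      by (simp add: \<theta> \<sigma>)
  qed (fact phi phi_mult_left phi_mult_right top_phi B.xmodule_axioms E.xmodule_axioms
      top.automorphism_action_axioms base.automorphism_action_axioms)+
  then interpret R: xmodule_action B E \<theta> \<sigma> \<phi>
    by (simp add: \<theta>_def \<sigma>_def \<phi>_def)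
  let ?F = "act_functor (make_action B E \<theta> \<sigma> \<phi>)"
  have on1: "\<lparr>xdom = E, xcod = E, mor_top = \<theta> p, mor_base = \<sigma> p\<rparr> = on1 F p"
    if "p \<in> carrier (base_group B)" for p
    using that mor[OF that] R.mor[OF that] by (intro xmor_eqI[of E E]) (simp_all add: \<theta> \<sigma>)
  have "on0 ?F = on0 F"
    by (auto simp: E_def F_def)
  \<comment> \<open>The extensionality demanded of strict 2-functors turns agreement on cells into
    equality of functions.\<close>
  moreover have "on1 ?F = on1 F"
  proof (rule extensionalityI[OF _ ext1])
    show "on1 ?F \<in> extensional (Arr (cells1 (two_cat_of B)))"
      by (simp add: make_action_def Let_def)
  qed (simp add: on1)
  moreover have "on2 ?F = on2 F"
  proof (rule extensionalityI[OF _ ext2])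
    show "on2 ?F \<in> extensional (Arr (vert (two_cat_of B)))"
      by (simp add: make_action_def Let_def)
    fix \<alpha> assume "\<alpha> \<in> Arr (vert (two_cat_of B))"
    then obtain m p where \<alpha>: "\<alpha> = (m, p)" "m \<in> carrier (top_group B)" "p \<in> carrier (base_group B)"
      by auto
    have "xmodule_cell E E (on1 F p) (on1 F (boundary B m \<otimes>\<^bsub>base_group B\<^esub> p)) (on2 ?F (m, p))"
      using R.cell[OF \<alpha>(2,3)] \<alpha> by (simp add: on1)
    from this cell[OF \<alpha>(2,3)] show "on2 ?F \<alpha> = on2 F \<alpha>"
      unfolding \<alpha>(1) by (rule xcell_eqI) (use \<alpha> in \<open>simp add: cmap\<close>)
  qed
  ultimately have "?F = F" by simp
  then show "A = make_action B E (action_top A) (action_base A) (action_phi A)"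
    by (simp add: \<theta>_def \<sigma>_def \<phi>_def B_def F_def make_action_def Let_def)
qed

section \<open>Morphisms of actions\<close>

text \<open>Restriction of the action along \<open>b\<close>. The explicit restrictions to carriers
  keep the new data extensional.\<close>

lemma xmodule_action_pullback:
  assumes "xmodule_action B' E \<theta> \<sigma> \<phi>" "xmodule_mor B B' b"
  shows "xmodule_action B E (\<lambda>p\<in>carrier (base_group B). \<theta> (mor_base b p))
    (\<lambda>p\<in>carrier (base_group B). \<sigma> (mor_base b p))
    (\<lambda>(m, x)\<in>carrier (top_group B) \<times> carrier (base_group E). \<phi> (mor_top b m, x))"
proof -
  interpret A: xmodule_action B' E \<theta> \<sigma> \<phi> by fact
  interpret b: xmodule_mor B B' b by fact
  have "(\<lambda>p\<in>carrier (base_group B). \<theta> (mor_base b p)) \<in> group_acts (base_group B) (top_group E)"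
    "(\<lambda>p\<in>carrier (base_group B). \<sigma> (mor_base b p)) \<in> group_acts (base_group B) (base_group E)"
    using A.top.acts_unfolded A.base.acts_unfolded
    unfolding group_acts_iff[OF b.X.G.is_group A.E.T.is_group] group_acts_iff[OF b.X.G.is_group A.E.G.is_group]
    by (auto simp: A.top.comp A.base.comp)
  then show ?thesis
    using b.X.xmodule_axioms A.E.xmodule_axioms
    by (intro xmodule_action.intro xmodule_action_axioms.intro automorphism_action.intro
        automorphism_action_axioms.intro)
      (auto simp: A.boundary_top A.top_act A.boundary_phi A.phi_boundary A.phi_mult_left
        A.phi_mult_right A.top_phi xmodule_def b.boundary_top b.X.G.is_group A.E.T.is_group A.E.G.is_group)
qed

text \<open>Brings the target of a transformation between actions of different crossed modules into
  the form \<open>make_action\<close> over the source actor, so that transformations need to be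
  analysed for one fixed actor only.\<close>

lemma two_functor_comp_make_action:
  assumes "xmodule_action B' E \<theta> \<sigma> \<phi>" "xmodule_mor B B' b"
  shows "two_functor_comp (two_cat_of B) (act_functor (make_action B' E \<theta> \<sigma> \<phi>)) (induced_two_functor b)
    = act_functor (make_action B E (\<lambda>p\<in>carrier (base_group B). \<theta> (mor_base b p))
      (\<lambda>p\<in>carrier (base_group B). \<sigma> (mor_base b p))
      (\<lambda>(m, x)\<in>carrier (top_group B) \<times> carrier (base_group E). \<phi> (mor_top b m, x)))"
    (is "?L = act_functor ?R")
proof -
  interpret A: xmodule_action B' E \<theta> \<sigma> \<phi> by fact
  interpret b: xmodule_mor B B' b by fact
  have "on0 ?L = on0 (act_functor ?R)"
    by (auto simp: two_functor_comp_def compose_def induced_two_functor_def)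
  moreover have "on1 ?L = on1 (act_functor ?R)"
    by (rule extensionalityI[of _ "carrier (base_group B)"])
      (auto simp: two_functor_comp_def induced_two_functor_def compose_eq,
        auto simp: make_action_def Let_def)
  moreover have "on2 ?L = on2 (act_functor ?R)"
    by (rule extensionalityI[of _ "carrier (top_group B) \<times> carrier (base_group B)"])
      (auto simp: two_functor_comp_def induced_two_functor_def compose_eq b.boundary_top cong: restrict_cong,
        auto simp: make_action_def Let_def)
  ultimately show ?thesis by simp
qed

text \<open>Naturality on 2-cells need only be tested at (m, 1). For general p it is that case at
  the argument \<open>\<sigma> p x\<close>, combined with equivariance of the base
  component.\<close>

lemma strict_transformation_iff:
  assumes "xmodule_action B E \<theta> \<sigma> \<phi>" "xmodule_action B E' \<theta>' \<sigma>' \<phi>'"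
  shows "strict_transformation (two_cat_of B) XMod2 (act_functor (make_action B E \<theta> \<sigma> \<phi>))
      (act_functor (make_action B E' \<theta>' \<sigma>' \<phi>')) N \<longleftrightarrow>
    xmodule_mor E E' (N ()) \<and>
    (\<forall>p\<in>carrier (base_group B). \<forall>t\<in>carrier (top_group E).
      mor_top (N ()) (\<theta> p t) = \<theta>' p (mor_top (N ()) t)) \<and>
    (\<forall>p\<in>carrier (base_group B). \<forall>x\<in>carrier (base_group E).
      mor_base (N ()) (\<sigma> p x) = \<sigma>' p (mor_base (N ()) x)) \<and>
    (\<forall>m\<in>carrier (top_group B). \<forall>x\<in>carrier (base_group E).
      mor_top (N ()) (\<phi> (m, x)) = \<phi>' (m, mor_base (N ()) x))"
    (is "?L \<longleftrightarrow> ?R")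
proof -
  interpret A: xmodule_action B E \<theta> \<sigma> \<phi> by fact
  interpret A': xmodule_action B E' \<theta>' \<sigma>' \<phi>' by fact
  let ?f = "\<lambda>p. \<lparr>xdom = E, xcod = E, mor_top = \<theta> p, mor_base = \<sigma> p\<rparr>"
  let ?g = "\<lambda>p. \<lparr>xdom = E', xcod = E', mor_top = \<theta>' p, mor_base = \<sigma>' p\<rparr>"
  let ?F = "act_functor (make_action B E \<theta> \<sigma> \<phi>)"
  let ?G = "act_functor (make_action B E' \<theta>' \<sigma>' \<phi>')"
  have "strict_two_functor (two_cat_of B) XMod2 ?F" "strict_two_functor (two_cat_of B) XMod2 ?G"
    using A.crossed_module_action_make_action A'.crossed_module_action_make_action
    by (simp_all add: crossed_module_action_def)
  then have "?L \<longleftrightarrow> xmodule_mor E E' (N ()) \<and>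
    (\<forall>p\<in>carrier (base_group B). Cmp XMod (N ()) (?f p) = Cmp XMod (?g p) (N ())) \<and>
    (\<forall>m\<in>carrier (top_group B). \<forall>p\<in>carrier (base_group B).
      HCmp XMod2 (Idn (vert XMod2) (N ())) (on2 ?F (m, p)) =
      HCmp XMod2 (on2 ?G (m, p)) (Idn (vert XMod2) (N ())))"
    by (auto simp: strict_transformation_def strict_transformation_axioms_def xmodule_mor_iff extensional_def)
  also have "\<dots> \<longleftrightarrow> ?R"
  proof (rule conj_cong[OF refl])
    assume N: "xmodule_mor E E' (N ())"
    then interpret N: xmodule_mor E E' "N ()" .
    have 1: "Cmp XMod (N ()) (?f p) = Cmp XMod (?g p) (N ()) \<longleftrightarrow>
      (\<forall>t\<in>carrier (top_group E). mor_top (N ()) (\<theta> p t) = \<theta>' p (mor_top (N ()) t)) \<and>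
      (\<forall>x\<in>carrier (base_group E). mor_base (N ()) (\<sigma> p x) = \<sigma>' p (mor_base (N ()) x))"
      (is "?l = ?r \<longleftrightarrow> ?S") if p: "p \<in> carrier (base_group B)" for p
    proof
      assume eq: "?l = ?r"
      have "mor_top ?l t = mor_top ?r t" "mor_base ?l x = mor_base ?r x" for t x
        by (simp_all only: eq)
      then show ?S by (auto simp: compose_def split: if_splits) metis+
    next
      assume ?S
      with xmodule_mor_Cmp[OF A.mor[OF p] N] xmodule_mor_Cmp[OF N A'.mor[OF p]]
      show "?l = ?r"
        by (rule_tac xmor_eqI) (auto simp: compose_eq)
    qed
    \<comment> \<open>The two composites are parallel only when \<open>N ()\<close> is natural on
      1-cells, at p for the sources and at \<mu> m times p for the targets; this is the extra
      premise on 1-cells.\<close>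
    have 2: "HCmp XMod2 (Idn (vert XMod2) (N ())) (on2 ?F (m, p)) =
        HCmp XMod2 (on2 ?G (m, p)) (Idn (vert XMod2) (N ())) \<longleftrightarrow>
      (\<forall>x\<in>carrier (base_group E). mor_top (N ()) (\<phi> (m, \<sigma> p x)) = \<phi>' (m, \<sigma>' p (mor_base (N ()) x)))"
      (is "?l = ?r \<longleftrightarrow> ?S")
      if m: "m \<in> carrier (top_group B)" and p: "p \<in> carrier (base_group B)"
        and eq: "\<And>p. p \<in> carrier (base_group B) \<Longrightarrow> Cmp XMod (N ()) (?f p) = Cmp XMod (?g p) (N ())"
      for m p
    proof
      assume eq: "?l = ?r"
      show ?S
      proof
        fix x assume "x \<in> carrier (base_group E)"
        moreover have "cmap ?l x = cmap ?r x"
          by (simp only: eq)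
        ultimately show "mor_top (N ()) (\<phi> (m, \<sigma> p x)) = \<phi>' (m, \<sigma>' p (mor_base (N ()) x))"
          using m p by simp
      qed
    next
      assume ?S
      have pm: "boundary B m \<otimes>\<^bsub>base_group B\<^esub> p \<in> carrier (base_group B)" using m p by simp
      from \<open>?S\<close> xmodule_cell_HCmp[OF A.cell[OF m p] xmodule_cell_Idn[OF N], unfolded eq[OF p] eq[OF pm]]
        xmodule_cell_HCmp[OF xmodule_cell_Idn[OF N] A'.cell[OF m p]]
      show "?l = ?r"
        using m p by (rule_tac xcell_eqI) auto
    qed
    show "(\<forall>p\<in>carrier (base_group B). Cmp XMod (N ()) (?f p) = Cmp XMod (?g p) (N ())) \<and>
        (\<forall>m\<in>carrier (top_group B). \<forall>p\<in>carrier (base_group B).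
          HCmp XMod2 (Idn (vert XMod2) (N ())) (on2 ?F (m, p)) =
          HCmp XMod2 (on2 ?G (m, p)) (Idn (vert XMod2) (N ()))) \<longleftrightarrow>
      (\<forall>p\<in>carrier (base_group B). \<forall>t\<in>carrier (top_group E).
        mor_top (N ()) (\<theta> p t) = \<theta>' p (mor_top (N ()) t)) \<and>
      (\<forall>p\<in>carrier (base_group B). \<forall>x\<in>carrier (base_group E).
        mor_base (N ()) (\<sigma> p x) = \<sigma>' p (mor_base (N ()) x)) \<and>
      (\<forall>m\<in>carrier (top_group B). \<forall>x\<in>carrier (base_group E).
        mor_top (N ()) (\<phi> (m, x)) = \<phi>' (m, mor_base (N ()) x))"
      (is "?A \<and> ?B \<longleftrightarrow> ?C \<and> ?D \<and> ?E")
    proof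
      assume L: "?A \<and> ?B"
      then have "?C \<and> ?D" using 1 by blast
      moreover have ?E
      proof (intro ballI)
        fix m x assume mx: "m \<in> carrier (top_group B)" "x \<in> carrier (base_group E)"
        \<comment> \<open>The instance p = 1, where both \<open>\<sigma>\<close> and
          \<open>\<sigma>'\<close> act trivially.\<close>
        have "\<forall>x\<in>carrier (base_group E). mor_top (N ()) (\<phi> (m, \<sigma> \<one>\<^bsub>base_group B\<^esub> x))
            = \<phi>' (m, \<sigma>' \<one>\<^bsub>base_group B\<^esub> (mor_base (N ()) x))"
          using L mx(1) by (subst 2[symmetric]) blast+
        then show "mor_top (N ()) (\<phi> (m, x)) = \<phi>' (m, mor_base (N ()) x)"
          using mx by simp
      qed
      ultimately show "?C \<and> ?D \<and> ?E" by blast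
    next
      assume R: "?C \<and> ?D \<and> ?E"
      then have ?A using 1 by blast
      moreover from this have ?B
        using R by (intro ballI) (subst 2, auto)
      ultimately show "?A \<and> ?B" ..
    qed
  qed
  finally show ?thesis .
qed

text \<open>Only the endpoints of \<open>n\<close> are fixed, so this single criterion serves for
  \<open>u\<close>, for \<open>v\<close> and for the arrows between Whitehead sequences.\<close>

lemma crossed_module_action_mor_iff:
  assumes "xmodule_action B E \<theta> \<sigma> \<phi>" "xmodule_action B' E' \<theta>' \<sigma>' \<phi>'"
    and dom: "adom n = make_action B E \<theta> \<sigma> \<phi>" and cod: "acod n = make_action B' E' \<theta>' \<sigma>' \<phi>'"
  shows "crossed_module_action_mor n \<longleftrightarrow>
    xmodule_mor B B' (actor_mor n) \<and> xmodule_mor E E' (act_trans n ()) \<and>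
    (\<forall>p\<in>carrier (base_group B). \<forall>t\<in>carrier (top_group E).
      mor_top (act_trans n ()) (\<theta> p t) = \<theta>' (mor_base (actor_mor n) p) (mor_top (act_trans n ()) t)) \<and>
    (\<forall>p\<in>carrier (base_group B). \<forall>x\<in>carrier (base_group E).
      mor_base (act_trans n ()) (\<sigma> p x) = \<sigma>' (mor_base (actor_mor n) p) (mor_base (act_trans n ()) x)) \<and>
    (\<forall>m\<in>carrier (top_group B). \<forall>x\<in>carrier (base_group E).
      mor_top (act_trans n ()) (\<phi> (m, x)) = \<phi>' (mor_top (actor_mor n) m, mor_base (act_trans n ()) x))"
proof -
  have "crossed_module_action_mor n \<longleftrightarrow> xmodule_mor B B' (actor_mor n) \<and>
    strict_transformation (two_cat_of B) XMod2 (act_functor (make_action B E \<theta> \<sigma> \<phi>))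
      (two_functor_comp (two_cat_of B) (act_functor (make_action B' E' \<theta>' \<sigma>' \<phi>'))
        (induced_two_functor (actor_mor n))) (act_trans n)"
    using xmodule_action.crossed_module_action_make_action[OF assms(1)]
      xmodule_action.crossed_module_action_make_action[OF assms(2)]
    by (auto simp: crossed_module_action_mor_def dom cod xmodule_mor_iff)
  also have "\<dots> \<longleftrightarrow> xmodule_mor B B' (actor_mor n) \<and> xmodule_mor E E' (act_trans n ()) \<and>
    (\<forall>p\<in>carrier (base_group B). \<forall>t\<in>carrier (top_group E).
      mor_top (act_trans n ()) (\<theta> p t) = \<theta>' (mor_base (actor_mor n) p) (mor_top (act_trans n ()) t)) \<and>
    (\<forall>p\<in>carrier (base_group B). \<forall>x\<in>carrier (base_group E).
      mor_base (act_trans n ()) (\<sigma> p x) = \<sigma>' (mor_base (actor_mor n) p) (mor_base (act_trans n ()) x)) \<and>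
    (\<forall>m\<in>carrier (top_group B). \<forall>x\<in>carrier (base_group E).
      mor_top (act_trans n ()) (\<phi> (m, x)) = \<phi>' (mor_top (actor_mor n) m, mor_base (act_trans n ()) x))"
  proof (rule conj_cong[OF refl])
    assume "xmodule_mor B B' (actor_mor n)"
    note b = assms(2) this
    show "strict_transformation (two_cat_of B) XMod2 (act_functor (make_action B E \<theta> \<sigma> \<phi>))
      (two_functor_comp (two_cat_of B) (act_functor (make_action B' E' \<theta>' \<sigma>' \<phi>'))
        (induced_two_functor (actor_mor n))) (act_trans n) \<longleftrightarrow> xmodule_mor E E' (act_trans n ()) \<and>
    (\<forall>p\<in>carrier (base_group B). \<forall>t\<in>carrier (top_group E).
      mor_top (act_trans n ()) (\<theta> p t) = \<theta>' (mor_base (actor_mor n) p) (mor_top (act_trans n ()) t)) \<and>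
    (\<forall>p\<in>carrier (base_group B). \<forall>x\<in>carrier (base_group E).
      mor_base (act_trans n ()) (\<sigma> p x) = \<sigma>' (mor_base (actor_mor n) p) (mor_base (act_trans n ()) x)) \<and>
    (\<forall>m\<in>carrier (top_group B). \<forall>x\<in>carrier (base_group E).
      mor_top (act_trans n ()) (\<phi> (m, x)) = \<phi>' (mor_top (actor_mor n) m, mor_base (act_trans n ()) x))"
      unfolding two_functor_comp_make_action[OF b]
        strict_transformation_iff[OF assms(1) xmodule_action_pullback[OF b]]
    proof (rule conj_cong[OF refl], goal_cases)
      case 1
      \<comment> \<open>What remains is to evaluate the restrictions in the pulled-back data;
        \<open>e\<close> keeps the arguments in the carriers of \<open>E'\<close>.\<close>
      then interpret e: xmodule_mor E E' "act_trans n ()" .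
      show ?case by auto
    qed
  qed
  finally show ?thesis .
qed

section \<open>The conjugation action in terms of elements\<close>

abbreviation conj_base :: "'u xmod \<Rightarrow> 'u \<Rightarrow> 'u \<Rightarrow> 'u" where
  "conj_base X \<equiv> \<lambda>p\<in>carrier (base_group X). \<lambda>q\<in>carrier (base_group X).
    p \<otimes>\<^bsub>base_group X\<^esub> q \<otimes>\<^bsub>base_group X\<^esub> inv\<^bsub>base_group X\<^esub> p"

abbreviation conj_phi :: "'u xmod \<Rightarrow> 'u \<times> 'u \<Rightarrow> 'u" where
  "conj_phi X \<equiv> \<lambda>(m, p)\<in>carrier (top_group X) \<times> carrier (base_group X).
    m \<otimes>\<^bsub>top_group X\<^esub> xm_act X p (inv\<^bsub>top_group X\<^esub> m)"

lemma xmodule_action_conj: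
  assumes "crossed_module X"
  shows "xmodule_action X X (xm_act X) (conj_base X) (conj_phi X)"
proof -
  interpret X: xmodule X by unfold_locales fact
  have "conj_base X \<in> group_acts (base_group X) (base_group X)"
    unfolding group_acts_iff[OF X.G.is_group X.G.is_group]
    by (auto simp: hom_def X.G.m_assoc X.G.inv_mult_group)
  then show ?thesis
    using X.xmodule_axioms
    by (intro xmodule_action.intro xmodule_action_axioms.intro X.act.automorphism_action_axioms
        automorphism_action.intro automorphism_action_axioms.intro X.G.is_group)
      (auto simp: X.G.m_assoc X.T.m_assoc X.G.inv_mult_group X.T.inv_mult_group X.act.comp)
qed

text \<open>An equality of records: restricting \<open>xm_act X p\<close> in \<open>conj_mor\<close>
  changes nothing, because the automorphisms of an action are extensional.\<close>

lemma conj_action_eq: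
  assumes "crossed_module X"
  shows "conj_action X = make_action X X (xm_act X) (conj_base X) (conj_phi X)"
proof -
  interpret X: xmodule X by unfold_locales fact
  have "conj_mor X p = \<lparr>xdom = X, xcod = X, mor_top = xm_act X p, mor_base = conj_base X p\<rparr>"
    if "p \<in> carrier (base_group X)" for p
    using that X.act.ext2[OF that] by (simp add: conj_mor_def Let_def extensional_restrict)
  then show ?thesis
    by (auto simp: conj_action_def make_action_def Let_def conj_cell_def compose_def
        intro!: restrict_ext)
qed

section \<open>Whitehead sequences and crossed squares\<close>

text \<open>Since I(u) and J(v) are identities, all that is left of \<open>u\<close> and
  \<open>v\<close> is their common component \<open>n\<close>. The equations are the conditions for
  \<open>u\<close> and \<open>v\<close> to be morphisms to, respectively from, a conjugation
  action.\<close>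

locale whitehead_data = xmodule_action B E \<theta> \<sigma> \<phi> + n: xmodule_mor E B n
  for B E :: "'u xmod" and \<theta> \<sigma> :: "'u \<Rightarrow> 'u \<Rightarrow> 'u" and \<phi> :: "'u \<times> 'u \<Rightarrow> 'u" and n :: "'u xmor" +
  assumes u_top: "\<lbrakk>p \<in> carrier (base_group B); t \<in> carrier (top_group E)\<rbrakk> \<Longrightarrow>
      mor_top n (\<theta> p t) = xm_act B p (mor_top n t)"
    and u_base: "\<lbrakk>p \<in> carrier (base_group B); x \<in> carrier (base_group E)\<rbrakk> \<Longrightarrow>
      mor_base n (\<sigma> p x) = p \<otimes>\<^bsub>base_group B\<^esub> mor_base n x \<otimes>\<^bsub>base_group B\<^esub> inv\<^bsub>base_group B\<^esub> p"
    and u_phi: "\<lbrakk>m \<in> carrier (top_group B); x \<in> carrier (base_group E)\<rbrakk> \<Longrightarrow>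
      mor_top n (\<phi> (m, x)) = m \<otimes>\<^bsub>top_group B\<^esub> xm_act B (mor_base n x) (inv\<^bsub>top_group B\<^esub> m)"
    and v_top: "\<lbrakk>x \<in> carrier (base_group E); t \<in> carrier (top_group E)\<rbrakk> \<Longrightarrow>
      \<theta> (mor_base n x) t = xm_act E x t"
    and v_base: "\<lbrakk>x \<in> carrier (base_group E); y \<in> carrier (base_group E)\<rbrakk> \<Longrightarrow>
      \<sigma> (mor_base n x) y = x \<otimes>\<^bsub>base_group E\<^esub> y \<otimes>\<^bsub>base_group E\<^esub> inv\<^bsub>base_group E\<^esub> x"
    and v_phi: "\<lbrakk>t \<in> carrier (top_group E); x \<in> carrier (base_group E)\<rbrakk> \<Longrightarrow>
      \<phi> (mor_top n t, x) = t \<otimes>\<^bsub>top_group E\<^esub> xm_act E x (inv\<^bsub>top_group E\<^esub> t)"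

definition make_seq :: "'u xmod \<Rightarrow> 'u xmod \<Rightarrow> ('u \<Rightarrow> 'u \<Rightarrow> 'u) \<Rightarrow> ('u \<Rightarrow> 'u \<Rightarrow> 'u) \<Rightarrow> ('u \<times> 'u \<Rightarrow> 'u) \<Rightarrow>
    'u xmor \<Rightarrow> 'u wseq" where
  "make_seq B E \<theta> \<sigma> \<phi> n = (let A = make_action B E \<theta> \<sigma> \<phi> in
    \<lparr>wobj = A,
     wu = \<lparr>adom = A, acod = conj_action B, act_trans = (\<lambda>_. n), actor_mor = Idn XMod B\<rparr>,
     wv = \<lparr>adom = conj_action E, acod = A, act_trans = (\<lambda>_. Idn XMod E), actor_mor = n\<rparr>\<rparr>)"

lemma functor_sel [simp]:
  "on_obj functor_I = actor" "on_arr functor_I = actor_mor"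
  "on_obj functor_J A = on0 (act_functor A) ()" "on_arr functor_J n = act_trans n ()"
  "on_obj functor_R = conj_action"
  "on_arr functor_R a = \<lparr>adom = conj_action (xdom a), acod = conj_action (xcod a),
      act_trans = (\<lambda>_. a), actor_mor = a\<rparr>"
  by (simp_all add: functor_I_def functor_J_def functor_R_def)

lemma XAct_sel [simp]:
  "Obj XAct = Collect crossed_module_action" "Arr XAct = Collect crossed_module_action_mor"
  "Dom XAct = adom" "Cod XAct = acod"
  "Idn XAct A = \<lparr>adom = A, acod = A, act_trans = (\<lambda>z. Idn XMod (on0 (act_functor A) z)),
    actor_mor = Idn XMod (actor A)\<rparr>"
  "Cmp XAct n' n = \<lparr>adom = adom n, acod = acod n',
    act_trans = (\<lambda>z. Cmp XMod (act_trans n' z) (act_trans n z)),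
    actor_mor = Cmp XMod (actor_mor n') (actor_mor n)\<rparr>"
  by (simp_all add: XAct_def)

abbreviation wseq :: "'u wseq \<Rightarrow> bool" where
  "wseq \<equiv> whitehead_sequence XAct XMod functor_I functor_R functor_J"

text \<open>\<open>u\<close> has an identity as actor component and \<open>v\<close> an identity as
  transformation, so one of the two morphisms disappears from each criterion. If \<open>n\<close> is
  not a morphism from \<open>E\<close> to \<open>B\<close>, both sides fail, the right one already
  at \<open>u\<close>.\<close>

lemma whitehead_data_iff:
  assumes "xmodule_action B E \<theta> \<sigma> \<phi>"
  shows "whitehead_data B E \<theta> \<sigma> \<phi> n \<longleftrightarrow>
    crossed_module_action_mor (wu (make_seq B E \<theta> \<sigma> \<phi> n)) \<and>
    crossed_module_action_mor (wv (make_seq B E \<theta> \<sigma> \<phi> n))"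
proof -
  interpret xmodule_action B E \<theta> \<sigma> \<phi> by fact
  note B = xmodule_action_conj[OF B.crossed_module]
  note E = xmodule_action_conj[OF E.crossed_module]
  show ?thesis
  proof (cases "xmodule_mor E B n")
    case True
    then interpret n: xmodule_mor E B n .
    have "crossed_module_action_mor (wu (make_seq B E \<theta> \<sigma> \<phi> n)) \<longleftrightarrow>
      (\<forall>p\<in>carrier (base_group B). \<forall>t\<in>carrier (top_group E).
        mor_top n (\<theta> p t) = xm_act B p (mor_top n t)) \<and>
      (\<forall>p\<in>carrier (base_group B). \<forall>x\<in>carrier (base_group E).
        mor_base n (\<sigma> p x) = p \<otimes>\<^bsub>base_group B\<^esub> mor_base n x \<otimes>\<^bsub>base_group B\<^esub> inv\<^bsub>base_group B\<^esub> p) \<and>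
      (\<forall>m\<in>carrier (top_group B). \<forall>x\<in>carrier (base_group E).
        mor_top n (\<phi> (m, x)) = m \<otimes>\<^bsub>top_group B\<^esub> xm_act B (mor_base n x) (inv\<^bsub>top_group B\<^esub> m))"
      using True xmodule_mor_Idn[OF B.crossed_module]
      by (subst crossed_module_action_mor_iff[OF xmodule_action_axioms B])
        (auto simp: make_seq_def conj_action_eq B.crossed_module Let_def)
    moreover have "crossed_module_action_mor (wv (make_seq B E \<theta> \<sigma> \<phi> n)) \<longleftrightarrow>
      (\<forall>x\<in>carrier (base_group E). \<forall>t\<in>carrier (top_group E). xm_act E x t = \<theta> (mor_base n x) t) \<and>
      (\<forall>x\<in>carrier (base_group E). \<forall>y\<in>carrier (base_group E).
        x \<otimes>\<^bsub>base_group E\<^esub> y \<otimes>\<^bsub>base_group E\<^esub> inv\<^bsub>base_group E\<^esub> x = \<sigma> (mor_base n x) y) \<and>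
      (\<forall>t\<in>carrier (top_group E). \<forall>x\<in>carrier (base_group E).
        t \<otimes>\<^bsub>top_group E\<^esub> xm_act E x (inv\<^bsub>top_group E\<^esub> t) = \<phi> (mor_top n t, x))"
      using True xmodule_mor_Idn[OF E.crossed_module]
      by (subst crossed_module_action_mor_iff[OF E xmodule_action_axioms])
        (auto simp: make_seq_def conj_action_eq E.crossed_module Let_def)
    ultimately show ?thesis
      using xmodule_action_axioms True
      by (auto simp: whitehead_data_def whitehead_data_axioms_def)
  next
    case False
    moreover have "\<not> crossed_module_action_mor (wu (make_seq B E \<theta> \<sigma> \<phi> n))"
      using False
      by (subst crossed_module_action_mor_iff[OF xmodule_action_axioms B])
        (auto simp: make_seq_def conj_action_eq B.crossed_module Let_def)
    ultimately show ?thesis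
      by (simp add: whitehead_data_def)
  qed
qed

lemma (in whitehead_data) whitehead_sequence_make_seq: "wseq (make_seq B E \<theta> \<sigma> \<phi> n)"
  using whitehead_data_iff[OF xmodule_action_axioms, of n] whitehead_data_axioms
    crossed_module_action_make_action
  by (simp add: whitehead_sequence_def Let_def) (simp add: make_seq_def Let_def)

lemma whitehead_sequence_cases:
  assumes "wseq w"
  obtains B E \<theta> \<sigma> \<phi> n where "whitehead_data B E \<theta> \<sigma> \<phi> n" "w = make_seq B E \<theta> \<sigma> \<phi> n"
proof -
  define A u v where "A = wobj w" and "u = wu w" and "v = wv w"
  have A: "crossed_module_action A" and u: "crossed_module_action_mor u" "adom u = A"
      "acod u = conj_action (actor A)" "actor_mor u = Idn XMod (actor A)"
    and v: "crossed_module_action_mor v" "adom v = conj_action (on0 (act_functor A) ())" "acod v = A"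
      "act_trans v () = Idn XMod (on0 (act_functor A) ())" "actor_mor v = act_trans u ()"
    using assms by (auto simp: whitehead_sequence_def Let_def A_def u_def v_def)
  obtain B E \<theta> \<sigma> \<phi> where act: "xmodule_action B E \<theta> \<sigma> \<phi>" and A_eq: "A = make_action B E \<theta> \<sigma> \<phi>"
    using crossed_module_actionD[OF A] by metis
  \<comment> \<open>The transformations of \<open>u\<close> and \<open>v\<close> are functions on
    \<open>unit\<close>, hence fixed by their value at \<open>()\<close>; the remaining fields are
    prescribed by the definition of a Whitehead sequence.\<close>
  have w: "w = make_seq B E \<theta> \<sigma> \<phi> (actor_mor v)"
    using u v by (auto simp: make_seq_def Let_def A_eq A_def[symmetric] u_def[symmetric] v_def[symmetric]
        intro!: whitehead.equality xaction_mor.equality)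
  have "whitehead_data B E \<theta> \<sigma> \<phi> (actor_mor v)"
    using whitehead_data_iff[OF act] u(1) v(1) w u_def v_def by metis
  with w that show ?thesis by blast
qed

section \<open>From Whitehead data to crossed squares\<close>

definition make_square :: "'u xmod \<Rightarrow> 'u xmod \<Rightarrow> ('u \<Rightarrow> 'u \<Rightarrow> 'u) \<Rightarrow> ('u \<Rightarrow> 'u \<Rightarrow> 'u) \<Rightarrow> ('u \<times> 'u \<Rightarrow> 'u) \<Rightarrow>
    'u xmor \<Rightarrow> 'u xsq" where
  "make_square B E \<theta> \<sigma> \<phi> n =
    \<lparr>sqT = top_group E, sqM = top_group B, sqG = base_group E, sqP = base_group B,
     sq_f = mor_top n, sq_d = boundary E, sq_mu = boundary B, sq_g = mor_base n,
     actT = \<theta>, actM = xm_act B, actG = \<sigma>, sq_phi = \<phi>\<rparr>"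

lemma make_square_sel [simp]:
  "sqT (make_square B E \<theta> \<sigma> \<phi> n) = top_group E" "sqM (make_square B E \<theta> \<sigma> \<phi> n) = top_group B"
  "sqG (make_square B E \<theta> \<sigma> \<phi> n) = base_group E" "sqP (make_square B E \<theta> \<sigma> \<phi> n) = base_group B"
  "sq_f (make_square B E \<theta> \<sigma> \<phi> n) = mor_top n" "sq_d (make_square B E \<theta> \<sigma> \<phi> n) = boundary E"
  "sq_mu (make_square B E \<theta> \<sigma> \<phi> n) = boundary B" "sq_g (make_square B E \<theta> \<sigma> \<phi> n) = mor_base n"
  "actT (make_square B E \<theta> \<sigma> \<phi> n) = \<theta>" "actM (make_square B E \<theta> \<sigma> \<phi> n) = xm_act B"
  "actG (make_square B E \<theta> \<sigma> \<phi> n) = \<sigma>" "sq_phi (make_square B E \<theta> \<sigma> \<phi> n) = \<phi>"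
  by (simp_all add: make_square_def)

lemma (in whitehead_data) crossed_square_make_square: "crossed_square (make_square B E \<theta> \<sigma> \<phi> n)"
proof -
  have hom: "mor_top n \<in> ext_hom (top_group E) (top_group B)"
    "mor_base n \<in> ext_hom (base_group E) (base_group B)"
    "boundary E \<in> ext_hom (top_group E) (base_group E)"
    "boundary B \<in> ext_hom (top_group B) (base_group B)"
    using n.top.homh n.base.homh E.bd.homh B.bd.homh n.top_ext n.base_ext E.boundary_ext B.boundary_ext
    by (simp_all add: ext_hom_def)
  have B: "crossed_module \<lparr>top_group = top_group B, base_group = base_group B, boundary = boundary B,
      xm_act = xm_act B\<rparr>"
    using B.crossed_module by (simp add: crossed_module_def)
  \<comment> \<open>The two axioms of a crossed module are here \<open>u_base\<close> and
    \<open>v_base\<close>.\<close>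
  have G: "crossed_module \<lparr>top_group = base_group E, base_group = base_group B, boundary = mor_base n,
      xm_act = \<sigma>\<rparr>"
    using hom E.ext_base B.ext_base base.acts
    by (simp add: crossed_module_def Let_def u_base v_base)
  have "compose (carrier (top_group E)) (boundary B) (mor_top n) \<in> hom (top_group E) (base_group B)"
    by (auto simp: hom_def compose_eq)
  \<comment> \<open>By \<open>v_top\<close> the element g (\<partial> t) acts on T as \<partial> t
    does in \<open>E\<close>, that is, by conjugation with t.\<close>
  moreover have "\<theta> (mor_base n (boundary E t)) s = t \<otimes>\<^bsub>top_group E\<^esub> s \<otimes>\<^bsub>top_group E\<^esub> inv\<^bsub>top_group E\<^esub> t"
    if "s \<in> carrier (top_group E)" "t \<in> carrier (top_group E)" for s t
    using that by (simp add: v_top)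
  ultimately have T: "crossed_module \<lparr>top_group = top_group E, base_group = base_group B,
      boundary = compose (carrier (top_group E)) (boundary B) (mor_top n), xm_act = \<theta>\<rparr>"
    using E.ext_top B.ext_base top.acts
    by (simp add: crossed_module_def Let_def ext_hom_def compose_eq u_top n.boundary_top)
  have right: "\<phi> (m, x \<otimes>\<^bsub>base_group E\<^esub> y) = \<phi> (m, x) \<otimes>\<^bsub>top_group E\<^esub> \<theta> (mor_base n x) (\<phi> (m, y))"
    if "m \<in> carrier (top_group B)" "x \<in> carrier (base_group E)" "y \<in> carrier (base_group E)" for m x y
    using that by (simp add: phi_mult_right v_top)
  show ?thesis
    using B G T hom E.ext_base B.ext_base E.ext_top B.ext_top top.acts base.acts B.act.acts phi
    by (simp add: crossed_square_def Let_def n.boundary_top boundary_top u_top u_phi v_phi v_top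
        boundary_phi phi_boundary phi_mult_left right top_phi)
qed

section \<open>From crossed squares to Whitehead data\<close>

definition sq_actor :: "'u xsq \<Rightarrow> 'u xmod" where
  "sq_actor S = \<lparr>top_group = sqM S, base_group = sqP S, boundary = sq_mu S, xm_act = actM S\<rparr>"

text \<open>G acts on T through g. The restriction makes this action extensional, as
  \<open>crossed_module\<close> demands.\<close>

definition sq_acted :: "'u xsq \<Rightarrow> 'u xmod" where
  "sq_acted S = \<lparr>top_group = sqT S, base_group = sqG S, boundary = sq_d S,
    xm_act = \<lambda>x\<in>carrier (sqG S). actT S (sq_g S x)\<rparr>"

definition sq_mor :: "'u xsq \<Rightarrow> 'u xmor" where
  "sq_mor S = \<lparr>xdom = sq_acted S, xcod = sq_actor S, mor_top = sq_f S, mor_base = sq_g S\<rparr>"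

lemma whitehead_data_crossed_square:
  assumes "crossed_square S"
  shows "whitehead_data (sq_actor S) (sq_acted S) (actT S) (actG S) (sq_phi S) (sq_mor S)"
proof -
  define T M G P f d g mu aT aM aG phi where "T = sqT S" and "M = sqM S" and "G = sqG S" and "P = sqP S"
    and "f = sq_f S" and "d = sq_d S" and "g = sq_g S" and "mu = sq_mu S"
    and "aT = actT S" and "aM = actM S" and "aG = actG S" and "phi = sq_phi S"
  note defs = this
  define B where "B = \<lparr>top_group = M, base_group = P, boundary = mu, xm_act = aM\<rparr>"
  define E where "E = \<lparr>top_group = T, base_group = G, boundary = d, xm_act = \<lambda>x\<in>carrier G. aT (g x)\<rparr>"
  define n where "n = \<lparr>xdom = E, xcod = B, mor_top = f, mor_base = g\<rparr>"
  note S = assms[unfolded crossed_square_def Let_def, folded defs]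
  interpret B: xmodule B
    using S by unfold_locales (simp add: B_def)
  interpret GP: xmodule "\<lparr>top_group = G, base_group = P, boundary = g, xm_act = aG\<rparr>"
    using S by unfold_locales simp
  interpret TP: xmodule "\<lparr>top_group = T, base_group = P, boundary = compose (carrier T) mu f, xm_act = aT\<rparr>"
    using S by unfold_locales simp
  have fd: "mu (f t) = g (d t)" if "t \<in> carrier T" for t
    using S that by auto
  note [simp] = B.act.closed[unfolded B_def, simplified] B.act.inv[unfolded B_def, simplified]
    B.bd.hom_closed[unfolded B_def, simplified] B.G.m_closed[unfolded B_def, simplified]
    B.G.inv_closed[unfolded B_def, simplified] B.T.inv_closed[unfolded B_def, simplified]
    GP.act.closed[simplified] GP.act.inv[simplified] GP.bd.hom_closed[simplified]
    GP.boundary_act[simplified] GP.peiffer[simplified] GP.bd.hom_mult[simplified]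
    TP.act.closed[simplified] TP.act.inv[simplified] TP.act.mult[simplified] TP.bd.hom_closed[simplified]
  have d: "d \<in> hom T G"
    using S by (auto simp: ext_hom_def)
  have dcl: "d t \<in> carrier G" if "t \<in> carrier T" for t
    using d that by (rule hom_in_carrier)
  have actE: "(\<lambda>x\<in>carrier G. aT (g x)) \<in> group_acts G T"
    using TP.act.acts_unfolded
    unfolding group_acts_iff[OF GP.T.is_group[simplified] TP.T.is_group[simplified]]
    by (auto simp: TP.act.comp[simplified] GP.T.m_closed[simplified] GP.T.one_closed[simplified]
        GP.bd.hom_one[simplified])
  \<comment> \<open>The formula for \<partial> combines its P-equivariance with the Peiffer identity
    of g; the Peiffer identity of \<open>E\<close> is that of the diagonal T to P, because g after
    \<partial> equals \<mu> after f.\<close>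
  have "crossed_module E"
    using S actE TP.peiffer[simplified] dcl
    by (simp add: E_def crossed_module_def Let_def fd compose_eq)
  then interpret E: xmodule E
    by unfold_locales
  \<comment> \<open>The law \<open>top_act\<close> is no axiom of a square. It holds because g sends
    \<open>aG p x\<close> to the conjugate of g x by p, so p times g x equals that conjugate times
    p.\<close>
  have "xmodule_action B E aT aG phi"
    using B.xmodule_axioms E.xmodule_axioms S TP.act.automorphism_action_axioms
      GP.act.automorphism_action_axioms
    by (intro xmodule_action.intro xmodule_action_axioms.intro)
      (auto simp: B_def E_def B.G.m_assoc[unfolded B_def, simplified] B.G.l_inv[unfolded B_def, simplified]
        B.G.r_one[unfolded B_def, simplified] simp flip: TP.act.comp[simplified])
  moreover have "xmodule_mor E B n"
    using S B.crossed_module E.crossed_module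
    by (auto simp: xmodule_mor_iff crossed_module_mor_def Let_def n_def E_def B_def)
  \<comment> \<open>\<open>v_top\<close> holds by construction of \<open>E\<close>;
    \<open>u_base\<close> and \<open>v_base\<close> are the two axioms of the crossed module on
    g.\<close>
  moreover have "whitehead_data_axioms B E aT aG phi n"
    using S by unfold_locales (auto simp: B_def E_def n_def)
  ultimately have "whitehead_data B E aT aG phi n"
    by (rule whitehead_data.intro)
  then show ?thesis
    by (simp add: B_def E_def n_def defs sq_actor_def sq_acted_def sq_mor_def)
qed

section \<open>The correspondence on objects and on arrows\<close>

definition seq_of_square :: "'u xsq \<Rightarrow> 'u wseq" where
  "seq_of_square S = make_seq (sq_actor S) (sq_acted S) (actT S) (actG S) (sq_phi S) (sq_mor S)"

definition square_of_seq :: "'u wseq \<Rightarrow> 'u xsq" where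
  "square_of_seq w = make_square (actor (wobj w)) (on0 (act_functor (wobj w)) ())
    (action_top (wobj w)) (action_base (wobj w)) (action_phi (wobj w)) (actor_mor (wv w))"

text \<open>The squares are separate arguments because an arrow of actions records only the actions,
  not the \<open>u\<close> and \<open>v\<close> of the sequences.\<close>

definition square_arrow :: "'u xsq \<Rightarrow> 'u xsq \<Rightarrow> 'u xaction_mor \<Rightarrow> 'u xsq_mor" where
  "square_arrow S S' n = \<lparr>sdom = S, scod = S',
    morT = mor_top (act_trans n ()), morM = mor_top (actor_mor n),
    morG = mor_base (act_trans n ()), morP = mor_base (actor_mor n)\<rparr>"

definition seq_mor_of_square_mor :: "'u xsq_mor \<Rightarrow> 'u wseq_mor" where
  "seq_mor_of_square_mor h = (let w = seq_of_square (sdom h); w' = seq_of_square (scod h) in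
    \<lparr>wdom = w, wcod = w', warr = \<lparr>adom = wobj w, acod = wobj w',
      act_trans = (\<lambda>_. \<lparr>xdom = sq_acted (sdom h), xcod = sq_acted (scod h), mor_top = morT h, mor_base = morG h\<rparr>),
      actor_mor = \<lparr>xdom = sq_actor (sdom h), xcod = sq_actor (scod h), mor_top = morM h, mor_base = morP h\<rparr>\<rparr>\<rparr>)"

definition square_mor_of_seq_mor :: "'u wseq_mor \<Rightarrow> 'u xsq_mor" where
  "square_mor_of_seq_mor k = square_arrow (square_of_seq (wdom k)) (square_of_seq (wcod k)) (warr k)"

text \<open>The data read off from the action agree with the given ones on the carriers, and both
  are extensional.\<close>

lemma (in whitehead_data) square_of_seq_make_seq:
  "square_of_seq (make_seq B E \<theta> \<sigma> \<phi> n) = make_square B E \<theta> \<sigma> \<phi> n"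
proof -
  let ?A = "make_action B E \<theta> \<sigma> \<phi>"
  have "action_top ?A = \<theta>"
    by (rule extensionalityI[OF _ top.ext]) (simp_all add: action_top_def)
  moreover have "action_base ?A = \<sigma>"
    by (rule extensionalityI[OF _ base.ext]) (simp_all add: action_base_def)
  moreover have "action_phi ?A = \<phi>"
    using phi by (intro extensionalityI[of _ "carrier (top_group B) \<times> carrier (base_group E)"])
      (auto simp: action_phi_def PiE_def)
  ultimately show ?thesis
    by (simp add: square_of_seq_def make_seq_def Let_def)
qed

text \<open>\<open>make_square\<close> forgets \<open>xm_act E\<close>; \<open>v_top\<close>
  recovers it as the action through \<open>mor_base n\<close>.\<close>

lemma (in whitehead_data) sq_make_square:
  "sq_actor (make_square B E \<theta> \<sigma> \<phi> n) = B" "sq_acted (make_square B E \<theta> \<sigma> \<phi> n) = E"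
  "sq_mor (make_square B E \<theta> \<sigma> \<phi> n) = n"
proof -
  show B: "sq_actor (make_square B E \<theta> \<sigma> \<phi> n) = B"
    by (simp add: sq_actor_def)
  have "(\<lambda>x\<in>carrier (base_group E). \<theta> (mor_base n x)) = xm_act E"
  proof (rule extensionalityI[OF _ E.act.ext])
    fix x assume "x \<in> carrier (base_group E)"
    then show "(\<lambda>x\<in>carrier (base_group E). \<theta> (mor_base n x)) x = xm_act E x"
      by (simp add: extensionalityI[OF top.ext2 E.act.ext2] v_top)
  qed simp
  then show E: "sq_acted (make_square B E \<theta> \<sigma> \<phi> n) = E"
    by (simp add: sq_acted_def)
  show "sq_mor (make_square B E \<theta> \<sigma> \<phi> n) = n"
    using n.xdom n.xcod by (simp add: sq_mor_def B E del: n.xdom n.xcod)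
qed

lemma wseq_seq_of_square: "crossed_square S \<Longrightarrow> wseq (seq_of_square S)"
  unfolding seq_of_square_def
  by (rule whitehead_data.whitehead_sequence_make_seq[OF whitehead_data_crossed_square])

lemma square_of_seq_of_square: "crossed_square S \<Longrightarrow> square_of_seq (seq_of_square S) = S"
  unfolding seq_of_square_def
  by (subst whitehead_data.square_of_seq_make_seq[OF whitehead_data_crossed_square])
    (simp_all add: make_square_def sq_actor_def sq_acted_def sq_mor_def)

lemma crossed_square_square_of_seq: "wseq w \<Longrightarrow> crossed_square (square_of_seq w)"
  by (elim whitehead_sequence_cases)
    (simp add: whitehead_data.square_of_seq_make_seq whitehead_data.crossed_square_make_square)

lemma seq_of_square_of_seq: "wseq w \<Longrightarrow> seq_of_square (square_of_seq w) = w"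
  by (elim whitehead_sequence_cases)
    (simp add: whitehead_data.square_of_seq_make_seq seq_of_square_def whitehead_data.sq_make_square)

section \<open>Morphisms of Whitehead sequences as morphisms of crossed squares\<close>

abbreviation wseq_mor :: "'u wseq_mor \<Rightarrow> bool" where
  "wseq_mor \<equiv> whitehead_sequence_mor XAct XMod functor_I functor_R functor_J"

lemma sq_sel [simp]:
  "top_group (sq_actor S) = sqM S" "base_group (sq_actor S) = sqP S"
  "boundary (sq_actor S) = sq_mu S" "xm_act (sq_actor S) = actM S"
  "top_group (sq_acted S) = sqT S" "base_group (sq_acted S) = sqG S"
  "boundary (sq_acted S) = sq_d S"
  "xm_act (sq_acted S) = (\<lambda>x\<in>carrier (sqG S). actT S (sq_g S x))"
  "xdom (sq_mor S) = sq_acted S" "xcod (sq_mor S) = sq_actor S"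
  "mor_top (sq_mor S) = sq_f S" "mor_base (sq_mor S) = sq_g S"
  by (simp_all add: sq_actor_def sq_acted_def sq_mor_def)

lemma seq_of_square_sel [simp]:
  "wobj (seq_of_square S) = make_action (sq_actor S) (sq_acted S) (actT S) (actG S) (sq_phi S)"
  "wu (seq_of_square S) = \<lparr>adom = make_action (sq_actor S) (sq_acted S) (actT S) (actG S) (sq_phi S),
    acod = conj_action (sq_actor S), act_trans = (\<lambda>_. sq_mor S), actor_mor = Idn XMod (sq_actor S)\<rparr>"
  "wv (seq_of_square S) = \<lparr>adom = conj_action (sq_acted S),
    acod = make_action (sq_actor S) (sq_acted S) (actT S) (actG S) (sq_phi S),
    act_trans = (\<lambda>_. Idn XMod (sq_acted S)), actor_mor = sq_mor S\<rparr>"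
  by (simp_all add: seq_of_square_def make_seq_def Let_def)

text \<open>Compatibility with \<open>u\<close> and compatibility with \<open>v\<close> amount to
  the same equation, commutation with (f, g); on the other component each only compares composites
  with identities. The two conditions on components keep their sources and targets, which
  \<open>square_arrow\<close> forgets.\<close>

lemma wseq_mor_iff:
  assumes "crossed_square S" "crossed_square S'"
    and k: "wdom k = seq_of_square S" "wcod k = seq_of_square S'"
    and n: "adom (warr k) = wobj (wdom k)" "acod (warr k) = wobj (wcod k)"
  shows "wseq_mor k \<longleftrightarrow>
    xmodule_mor (sq_acted S) (sq_acted S') (act_trans (warr k) ()) \<and>
    xmodule_mor (sq_actor S) (sq_actor S') (actor_mor (warr k)) \<and>
    crossed_square_mor (square_arrow S S' (warr k))"
proof -
  interpret W: whitehead_data "sq_actor S" "sq_acted S" "actT S" "actG S" "sq_phi S" "sq_mor S"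
    by (rule whitehead_data_crossed_square) fact
  interpret W': whitehead_data "sq_actor S'" "sq_acted S'" "actT S'" "actG S'" "sq_phi S'" "sq_mor S'"
    by (rule whitehead_data_crossed_square) fact
  note iff = crossed_module_action_mor_iff[OF W.xmodule_action_axioms W'.xmodule_action_axioms
      n[unfolded k, simplified]]
  define b e where "b = actor_mor (warr k)" and "e = act_trans (warr k) ()"
  show ?thesis
  proof (cases "xmodule_mor (sq_acted S) (sq_acted S') e \<and> xmodule_mor (sq_actor S) (sq_actor S') b")
    case True
    then interpret e: xmodule_mor "sq_acted S" "sq_acted S'" e by simp
    from True interpret b: xmodule_mor "sq_actor S" "sq_actor S'" b by simp
    have nat: "Cmp XMod b (sq_mor S) = Cmp XMod (sq_mor S') e \<longleftrightarrow>
        (\<forall>t\<in>carrier (sqT S). sq_f S' (mor_top e t) = mor_top b (sq_f S t)) \<and>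
        (\<forall>x\<in>carrier (sqG S). sq_g S' (mor_base e x) = mor_base b (sq_g S x))"
      (is "?l = ?r \<longleftrightarrow> ?R")
    proof
      assume eq: "?l = ?r"
      have "mor_top ?l t = mor_top ?r t" "mor_base ?l x = mor_base ?r x" for t x
        by (simp_all only: eq)
      then show ?R by (simp add: compose_def) metis
    next
      assume ?R
      with xmodule_mor_Cmp[OF W.n.xmodule_mor_axioms b.xmodule_mor_axioms]
        xmodule_mor_Cmp[OF e.xmodule_mor_axioms W'.n.xmodule_mor_axioms]
      show "?l = ?r"
        by (rule_tac xmor_eqI) (auto simp: compose_eq)
    qed
    have "wseq_mor k \<longleftrightarrow> crossed_module_action_mor (warr k) \<and> Cmp XMod b (sq_mor S) = Cmp XMod (sq_mor S') e"
      using assms(1,2) n e.xdom e.xcod b.xdom b.xcod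
        XMod_Cmp_Idn_right[OF e.xmodule_mor_axioms] XMod_Cmp_Idn_left[OF e.xmodule_mor_axioms]
        XMod_Cmp_Idn_right[OF b.xmodule_mor_axioms] XMod_Cmp_Idn_left[OF b.xmodule_mor_axioms]
      by (auto simp: whitehead_sequence_mor_def Let_def k wseq_seq_of_square b_def e_def fun_eq_iff)
    also have "\<dots> \<longleftrightarrow> crossed_square_mor (square_arrow S S' (warr k))"
      using assms(1,2) e.top.homh e.base.homh b.top.homh b.base.homh e.top_ext e.base_ext b.top_ext b.base_ext
        e.boundary_top b.boundary_top b.top_act True
      unfolding nat iff crossed_square_mor_def Let_def square_arrow_def
      by (auto simp: ext_hom_def b_def e_def)
    finally show ?thesis
      using True by (simp add: b_def e_def)
  next
    case False
    then have "\<not> crossed_module_action_mor (warr k)"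
      unfolding iff by (auto simp: b_def e_def)
    with False show ?thesis
      by (auto simp: whitehead_sequence_mor_def Let_def b_def e_def)
  qed
qed

section \<open>The isomorphism\<close>

lemma xmodule_mor_square_mor:
  assumes "crossed_square_mor h"
  shows "xmodule_mor (sq_acted (sdom h)) (sq_acted (scod h))
      \<lparr>xdom = sq_acted (sdom h), xcod = sq_acted (scod h), mor_top = morT h, mor_base = morG h\<rparr>" (is ?E)
    and "xmodule_mor (sq_actor (sdom h)) (sq_actor (scod h))
      \<lparr>xdom = sq_actor (sdom h), xcod = sq_actor (scod h), mor_top = morM h, mor_base = morP h\<rparr>" (is ?B)
proof -
  define S S' where "S = sdom h" and "S' = scod h"
  have h: "crossed_square S" "crossed_square S'"
    using assms by (simp_all add: crossed_square_mor_def Let_def S_def S'_def)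
  interpret W: whitehead_data "sq_actor S" "sq_acted S" "actT S" "actG S" "sq_phi S" "sq_mor S"
    by (rule whitehead_data_crossed_square) fact
  interpret W': whitehead_data "sq_actor S'" "sq_acted S'" "actT S'" "actG S'" "sq_phi S'" "sq_mor S'"
    by (rule whitehead_data_crossed_square) fact
  note h = assms[unfolded crossed_square_mor_def Let_def, folded S_def S'_def]
  \<comment> \<open>Needed to evaluate the restricted action of \<open>sq_acted S'\<close> at this
    element.\<close>
  have "morG h x \<in> carrier (sqG S')" if "x \<in> carrier (sqG S)" for x
    using h that by (auto simp: ext_hom_def dest: hom_in_carrier)
  then show ?E ?B
    using h W.E.crossed_module W.B.crossed_module W'.E.crossed_module W'.B.crossed_module
      W.n.base.hom_closed
    by (simp_all add: xmodule_mor_iff crossed_module_mor_def Let_def S_def S'_def)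
qed

lemma square_arrow_seq_mor:
  "square_arrow (sdom h) (scod h) (warr (seq_mor_of_square_mor h)) = h"
  by (simp add: square_arrow_def seq_mor_of_square_mor_def Let_def)

lemma wseq_mor_seq_mor_of_square_mor:
  assumes "crossed_square_mor h"
  shows "wseq_mor (seq_mor_of_square_mor h)"
proof -
  have "crossed_square (sdom h)" "crossed_square (scod h)"
    using assms by (simp_all add: crossed_square_mor_def Let_def)
  then show ?thesis
    using assms xmodule_mor_square_mor[OF assms]
    by (subst wseq_mor_iff[of "sdom h" "scod h"])
      (simp_all add: square_arrow_seq_mor, simp_all add: seq_mor_of_square_mor_def Let_def)
qed

lemma wseq_morD:
  assumes "wseq_mor k"
  shows "crossed_square_mor (square_mor_of_seq_mor k)"
    and "seq_mor_of_square_mor (square_mor_of_seq_mor k) = k"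
proof -
  define S S' where "S = square_of_seq (wdom k)" and "S' = square_of_seq (wcod k)"
  have k: "wseq (wdom k)" "wseq (wcod k)"
    and n: "adom (warr k) = wobj (wdom k)" "acod (warr k) = wobj (wcod k)"
    using assms by (simp_all add: whitehead_sequence_mor_def Let_def)
  have S: "crossed_square S" "crossed_square S'" "wdom k = seq_of_square S" "wcod k = seq_of_square S'"
    using k by (simp_all add: S_def S'_def crossed_square_square_of_seq seq_of_square_of_seq)
  have *: "xmodule_mor (sq_acted S) (sq_acted S') (act_trans (warr k) ())"
    "xmodule_mor (sq_actor S) (sq_actor S') (actor_mor (warr k))"
    "crossed_square_mor (square_arrow S S' (warr k))"
    using assms wseq_mor_iff[OF S n] by blast+
  then show "crossed_square_mor (square_mor_of_seq_mor k)"
    by (simp add: square_mor_of_seq_mor_def S_def S'_def)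
  \<comment> \<open>The endpoints of the two components, lost in \<open>square_arrow\<close>, are
    restored from the first two facts in \<open>*\<close>.\<close>
  show "seq_mor_of_square_mor (square_mor_of_seq_mor k) = k"
    using * n unfolding square_mor_of_seq_mor_def S_def[symmetric] S'_def[symmetric]
    by (auto simp: seq_mor_of_square_mor_def square_arrow_def S xmodule_mor_iff
        intro!: whitehead_mor.equality xaction_mor.equality xmor.equality)
qed

lemma square_mor_of_seq_mor_of_square_mor:
  assumes "crossed_square_mor h"
  shows "square_mor_of_seq_mor (seq_mor_of_square_mor h) = h"
proof -
  have "crossed_square (sdom h)" "crossed_square (scod h)"
    using assms by (simp_all add: crossed_square_mor_def Let_def)
  then show ?thesis
    using square_arrow_seq_mor[of h]
    by (simp add: square_mor_of_seq_mor_def square_of_seq_of_square)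
      (simp add: seq_mor_of_square_mor_def Let_def square_of_seq_of_square)
qed

section \<open>The category of crossed squares, verified directly on elements\<close>

lemma XSq_sel [simp]:
  "Obj XSq = Collect crossed_square" "Arr XSq = Collect crossed_square_mor"
  "Dom XSq = sdom" "Cod XSq = scod"
  "Idn XSq S = \<lparr>sdom = S, scod = S,
    morT = (\<lambda>t\<in>carrier (sqT S). t), morM = (\<lambda>m\<in>carrier (sqM S). m),
    morG = (\<lambda>x\<in>carrier (sqG S). x), morP = (\<lambda>p\<in>carrier (sqP S). p)\<rparr>"
  "Cmp XSq k h = \<lparr>sdom = sdom h, scod = scod k,
    morT = compose (carrier (sqT (sdom h))) (morT k) (morT h),
    morM = compose (carrier (sqM (sdom h))) (morM k) (morM h),
    morG = compose (carrier (sqG (sdom h))) (morG k) (morG h),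
    morP = compose (carrier (sqP (sdom h))) (morP k) (morP h)\<rparr>"
  by (simp_all add: XSq_def)

lemma crossed_square_mor_Idn:
  assumes "crossed_square S"
  shows "crossed_square_mor (Idn XSq S)"
proof -
  interpret W: whitehead_data "sq_actor S" "sq_acted S" "actT S" "actG S" "sq_phi S" "sq_mor S"
    by (rule whitehead_data_crossed_square) fact
  show ?thesis
    using assms W.top.closed W.base.closed W.B.act.closed W.n.top.hom_closed W.n.base.hom_closed
      W.E.bd.hom_closed W.B.bd.hom_closed W.phi_closed W.E.T.m_closed W.E.G.m_closed
      W.B.T.m_closed W.B.G.m_closed
    by (simp add: crossed_square_mor_def Let_def ext_hom_def hom_def)
qed

lemma ext_hom_compose:
  "f \<in> ext_hom G H \<Longrightarrow> g \<in> ext_hom H K \<Longrightarrow> group G \<Longrightarrow> compose (carrier G) g f \<in> ext_hom G K"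
  by (auto simp: ext_hom_def hom_def compose_eq group.is_monoid monoid.m_closed Pi_iff)

lemma crossed_square_mor_Cmp:
  assumes "crossed_square_mor h" "crossed_square_mor k" "scod h = sdom k"
  shows "crossed_square_mor (Cmp XSq k h)"
proof -
  define S where "S = sdom h"
  have h: "crossed_square S"
    using assms by (simp add: crossed_square_mor_def Let_def S_def)
  interpret W: whitehead_data "sq_actor S" "sq_acted S" "actT S" "actG S" "sq_phi S" "sq_mor S"
    by (rule whitehead_data_crossed_square) fact
  note h = assms(1)[unfolded crossed_square_mor_def Let_def assms(3), folded S_def]
  note k = assms(2)[unfolded crossed_square_mor_def Let_def]
  have *: "\<And>t. t \<in> carrier (sqT S) \<Longrightarrow> morT h t \<in> carrier (sqT (sdom k))"
    "\<And>t. t \<in> carrier (sqM S) \<Longrightarrow> morM h t \<in> carrier (sqM (sdom k))"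
    "\<And>t. t \<in> carrier (sqG S) \<Longrightarrow> morG h t \<in> carrier (sqG (sdom k))"
    "\<And>t. t \<in> carrier (sqP S) \<Longrightarrow> morP h t \<in> carrier (sqP (sdom k))"
    using h by (auto simp: ext_hom_def dest: hom_in_carrier)
  have "group (sqT S)" "group (sqM S)" "group (sqG S)" "group (sqP S)"
    using W.E.T.is_group W.B.T.is_group W.E.G.is_group W.B.G.is_group by simp_all
  then show ?thesis
    using h k * W.top.closed W.base.closed W.B.act.closed W.n.top.hom_closed W.n.base.hom_closed
      W.E.bd.hom_closed W.B.bd.hom_closed W.phi_closed
    by (simp add: crossed_square_mor_def Let_def S_def[symmetric] compose_eq ext_hom_compose[of _ _ "sqT (sdom k)"]
        ext_hom_compose[of _ _ "sqM (sdom k)"] ext_hom_compose[of _ _ "sqG (sdom k)"] ext_hom_compose[of _ _ "sqP (sdom k)"])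
qed

lemma category_XSq: "category (XSq :: ('u xsq, 'u xsq_mor) cat)"
proof
  fix f g h :: "'u xsq_mor"
  assume "f \<in> Arr XSq"
  then have f: "crossed_square_mor f" by simp
  then have fs: "crossed_square (sdom f)" "crossed_square (scod f)"
    and fh: "morT f \<in> ext_hom (sqT (sdom f)) (sqT (scod f))"
      "morM f \<in> ext_hom (sqM (sdom f)) (sqM (scod f))"
      "morG f \<in> ext_hom (sqG (sdom f)) (sqG (scod f))"
      "morP f \<in> ext_hom (sqP (sdom f)) (sqP (scod f))"
    by (simp_all add: crossed_square_mor_def Let_def)
  have [simp]: "compose A u (\<lambda>x\<in>A. x) = u" if "u \<in> extensional A" for A and u :: "'u \<Rightarrow> 'u"
    using that by (auto simp: compose_def extensional_def)
  show "Dom XSq f \<in> Obj XSq \<and> Cod XSq f \<in> Obj XSq"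
    using fs by simp
  show "Cmp XSq f (Idn XSq (Dom XSq f)) = f"
    using fh by (intro xsq_mor.equality) (simp_all add: ext_hom_def)
  show "Cmp XSq (Idn XSq (Cod XSq f)) f = f"
    using fh by (intro xsq_mor.equality) (simp_all add: ext_hom_def hom_def Id_compose)
  assume "g \<in> Arr XSq" "Cod XSq f = Dom XSq g"
  then have g: "crossed_square_mor g" "scod f = sdom g" by simp_all
  show "Cmp XSq g f \<in> Arr XSq \<and> Dom XSq (Cmp XSq g f) = Dom XSq f \<and> Cod XSq (Cmp XSq g f) = Cod XSq g"
    using crossed_square_mor_Cmp[OF f g] by simp
  assume "h \<in> Arr XSq" "Cod XSq g = Dom XSq h"
  then show "Cmp XSq h (Cmp XSq g f) = Cmp XSq (Cmp XSq h g) f"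
    using fh g by (simp add: ext_hom_def hom_def compose_assoc)
next
  fix S :: "'u xsq"
  assume "S \<in> Obj XSq"
  then show "Idn XSq S \<in> Arr XSq \<and> Dom XSq (Idn XSq S) = S \<and> Cod XSq (Idn XSq S) = S"
    using crossed_square_mor_Idn[of S] by simp
qed

section \<open>Transport to Whitehead sequences\<close>

lemma WSeq_sel [simp]:
  "Obj WSeq = Collect wseq" "Arr WSeq = Collect wseq_mor" "Dom WSeq = wdom" "Cod WSeq = wcod"
  "Idn WSeq w = \<lparr>wdom = w, wcod = w, warr = Idn XAct (wobj w)\<rparr>"
  "Cmp WSeq k' k = \<lparr>wdom = wdom k, wcod = wcod k', warr = Cmp XAct (warr k') (warr k)\<rparr>"
  by (simp_all add: WSeq_def whitehead_category_def)

lemma seq_mor_of_square_mor_sel [simp]: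
  "wdom (seq_mor_of_square_mor h) = seq_of_square (sdom h)"
  "wcod (seq_mor_of_square_mor h) = seq_of_square (scod h)"
  by (simp_all add: seq_mor_of_square_mor_def Let_def)

text \<open>The axioms of the second category come for free by transport along the bijections.\<close>

lemma isomorphic_categories_transport:
  fixes C :: "('o, 'a) cat" and D :: "('p, 'b) cat"
  assumes "category D"
    and obj: "\<And>x. x \<in> Obj C \<Longrightarrow> F x \<in> Obj D" "\<And>x. x \<in> Obj C \<Longrightarrow> G (F x) = x"
      "\<And>y. y \<in> Obj D \<Longrightarrow> G y \<in> Obj C" "\<And>y. y \<in> Obj D \<Longrightarrow> F (G y) = y"
    and arr: "\<And>f. f \<in> Arr C \<Longrightarrow> F' f \<in> Arr D" "\<And>f. f \<in> Arr C \<Longrightarrow> G' (F' f) = f"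
      "\<And>g. g \<in> Arr D \<Longrightarrow> G' g \<in> Arr C" "\<And>g. g \<in> Arr D \<Longrightarrow> F' (G' g) = g"
    and dom: "\<And>g. g \<in> Arr D \<Longrightarrow> Dom C (G' g) = G (Dom D g)"
    and cod: "\<And>g. g \<in> Arr D \<Longrightarrow> Cod C (G' g) = G (Cod D g)"
    and idn: "\<And>y. y \<in> Obj D \<Longrightarrow> G' (Idn D y) = Idn C (G y)"
    and cmp: "\<And>f g. \<lbrakk>f \<in> Arr D; g \<in> Arr D; Cod D f = Dom D g\<rbrakk> \<Longrightarrow> G' (Cmp D g f) = Cmp C (G' g) (G' f)"
  shows "isomorphic_categories C D"
proof -
  interpret D: category D by fact
  have dom': "Dom C f = G (Dom D (F' f))" and cod': "Cod C f = G (Cod D (F' f))" if "f \<in> Arr C" for f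
    using dom[of "F' f"] cod[of "F' f"] arr that by auto
  have inj: "y = z" if "G y = G z" "y \<in> Obj D" "z \<in> Obj D" for y z
    using obj that by metis
  \<comment> \<open>Composability passes from \<open>C\<close> to \<open>D\<close> because
    \<open>G\<close>, having a left inverse, is injective on the objects of
    \<open>D\<close>.\<close>
  have comp: "Cod D (F' f) = Dom D (F' g)" if "f \<in> Arr C" "g \<in> Arr C" "Cod C f = Dom C g" for f g
    using that dom' cod' arr D.dom_cod by (intro inj) auto
  have cmp': "Cmp C g f = G' (Cmp D (F' g) (F' f))"
    if "f \<in> Arr C" "g \<in> Arr C" "Cod C f = Dom C g" for f g
    using cmp[OF _ _ comp[OF that]] arr that by simp
  have idn': "Idn C x = G' (Idn D (F x))" if "x \<in> Obj C" for x
    using idn obj that by simp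
  have "category C"
  proof
    fix f g h
    assume f: "f \<in> Arr C"
    show "Dom C f \<in> Obj C \<and> Cod C f \<in> Obj C"
      using f arr obj D.dom_cod by (simp add: dom' cod')
    then have fo: "Dom C f \<in> Obj C" "Cod C f \<in> Obj C" by simp_all
    have 1: "F' f \<in> Arr D" "Dom D (F' f) \<in> Obj D" "Cod D (F' f) \<in> Obj D"
      using f arr D.dom_cod by auto
    show "Cmp C f (Idn C (Dom C f)) = f"
      using f arr cmp[of "Idn D (Dom D (F' f))" "F' f"] D.idn[OF 1(2)] D.idn_right[OF 1(1)] 1
      by (simp add: dom' idn)
    show "Cmp C (Idn C (Cod C f)) f = f"
      using f arr cmp[of "F' f" "Idn D (Cod D (F' f))"] D.idn[OF 1(3)] D.idn_left[OF 1(1)] 1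
      by (simp add: cod' idn)
    assume g: "g \<in> Arr C" "Cod C f = Dom C g"
    note 2 = D.cmp[OF 1(1) arr(1)[OF g(1)] comp[OF f g]]
    show "Cmp C g f \<in> Arr C \<and> Dom C (Cmp C g f) = Dom C f \<and> Cod C (Cmp C g f) = Cod C g"
      using 2 f g arr by (simp add: cmp' dom cod dom' cod')
    assume h: "h \<in> Arr C" "Cod C g = Dom C h"
    note 3 = D.cmp[OF arr(1)[OF g(1)] arr(1)[OF h(1)] comp[OF g(1) h]]
    have "Cmp C h (Cmp C g f) = G' (Cmp D (F' h) (Cmp D (F' g) (F' f)))"
      using cmp[of "Cmp D (F' g) (F' f)" "F' h"] 2 comp[OF g(1) h] arr f g h by (simp add: cmp')
    also have "\<dots> = G' (Cmp D (Cmp D (F' h) (F' g)) (F' f))"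
      using D.assoc[OF 1(1) arr(1)[OF g(1)] arr(1)[OF h(1)] comp[OF f g] comp[OF g(1) h]] by simp
    also have "\<dots> = Cmp C (Cmp C h g) f"
      using cmp[of "F' f" "Cmp D (F' h) (F' g)"] 3 comp[OF f g] arr f g h by (simp add: cmp')
    finally show "Cmp C h (Cmp C g f) = Cmp C (Cmp C h g) f" .
  next
    fix x assume "x \<in> Obj C"
    with obj D.idn[of "F x"] arr show "Idn C x \<in> Arr C \<and> Dom C (Idn C x) = x \<and> Cod C (Idn C x) = x"
      by (simp add: idn' dom cod)
  qed
  then interpret C: category C .
  have "cat_functor C D \<lparr>on_obj = F, on_arr = F'\<rparr>"
  proof
    fix x assume "x \<in> Obj C"
    then show "on_obj \<lparr>on_obj = F, on_arr = F'\<rparr> x \<in> Obj D"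
      "on_arr \<lparr>on_obj = F, on_arr = F'\<rparr> (Idn C x) = Idn D (on_obj \<lparr>on_obj = F, on_arr = F'\<rparr> x)"
      using obj arr D.idn by (simp_all add: idn')
  next
    fix f g assume f: "f \<in> Arr C"
    then show "on_arr \<lparr>on_obj = F, on_arr = F'\<rparr> f \<in> Arr D \<and>
      Dom D (on_arr \<lparr>on_obj = F, on_arr = F'\<rparr> f) = on_obj \<lparr>on_obj = F, on_arr = F'\<rparr> (Dom C f) \<and>
      Cod D (on_arr \<lparr>on_obj = F, on_arr = F'\<rparr> f) = on_obj \<lparr>on_obj = F, on_arr = F'\<rparr> (Cod C f)"
      using obj arr D.dom_cod by (simp add: dom' cod')
    assume g: "g \<in> Arr C" "Cod C f = Dom C g"
    show "on_arr \<lparr>on_obj = F, on_arr = F'\<rparr> (Cmp C g f)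
      = Cmp D (on_arr \<lparr>on_obj = F, on_arr = F'\<rparr> g) (on_arr \<lparr>on_obj = F, on_arr = F'\<rparr> f)"
      using D.cmp[OF arr(1) arr(1) comp, OF f g(1) f g] arr f g by (simp add: cmp')
  qed
  moreover have "cat_functor D C \<lparr>on_obj = G, on_arr = G'\<rparr>"
    using obj arr dom cod idn cmp by unfold_locales auto
  ultimately show ?thesis
    unfolding isomorphic_categories_def using obj arr
    by (intro exI[of _ "\<lparr>on_obj = F, on_arr = F'\<rparr>"] exI[of _ "\<lparr>on_obj = G, on_arr = G'\<rparr>"]) simp
qed

theorem theorem3p2:
  "isomorphic_categories (WSeq :: ('u wseq, 'u wseq_mor) cat) (XSq :: ('u xsq, 'u xsq_mor) cat)"
proof (rule isomorphic_categories_transport[where F = square_of_seq and G = seq_of_square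
      and F' = square_mor_of_seq_mor and G' = seq_mor_of_square_mor])
  show "category (XSq :: ('u xsq, 'u xsq_mor) cat)"
    by (rule category_XSq)
  fix S :: "'u xsq"
  \<comment> \<open>No hypothesis on \<open>S\<close> is involved: identities on both sides are the
    same restricted identity maps, packed into records.\<close>
  show "seq_mor_of_square_mor (Idn XSq S) = Idn WSeq (seq_of_square S)"
    by (simp add: seq_mor_of_square_mor_def Let_def XMod_def)
next
  fix h k :: "'u xsq_mor"
  show "seq_mor_of_square_mor (Cmp XSq k h) = Cmp WSeq (seq_mor_of_square_mor k) (seq_mor_of_square_mor h)"
    by (simp add: seq_mor_of_square_mor_def Let_def XMod_def)
qed (simp_all add: crossed_square_square_of_seq seq_of_square_of_seq wseq_seq_of_square
    square_of_seq_of_square wseq_morD wseq_mor_seq_mor_of_square_mor square_mor_of_seq_mor_of_square_mor)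

end
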